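(* Let $G=(V,E)$ be a finite complete graph, let $V_1,V_2$ be a disjoint decomposition of $V$ (i.e. $V=V_1\cup V_2$ and $V_1\cap V_2=\emptyset$), let $H\subset V$, and let $p,p'\in[0,1)$. Define probability weights $p_G\in[0,1]^{E\cup V}$ by $p_{uv}=0$ for all $u\neq v$ in $V_1$; $p_{uv}=p$ for all $u\in V_1$, $v\in V_2$; $p_{uv}=p'$ for all $u\ne v$ in $V_2$; $p_u=1$ for all $u\in H$; and $p_u=0$ for all $u\in V\setminus H$. Then $$\forall\, v,w\in V:\quad \mathbb{P}_{p_G}(v_-\leftrightarrow w_-)\ \ge\ \mathbb{P}_{p_G}(v_-\leftrightarrow w_+).$$ In particular, the bunkbed property (B2) holds for all (finite) complete bipartite graphs, and for all graphs obtained from a (finite) complete graph by removing the edges of an arbitrary complete subgraph.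
   Context: All graphs are simple and undirected; $uv$ denotes the edge $\{u,v\}$. For a finite graph $G=(V,E)$ the bunkbed graph $G^\pm=(V^\pm,E^\pm)$ has vertex set $V^\pm:=V\times\{+,-\}$, where we write $v_+:=(v,+)$ and $v_-:=(v,-)$, and edge set $E^\pm:=\{u_+v_+,\,u_-v_-: uv\in E\}\cup\{u_+u_-: u\in V\}$. Given weights $p_G=(p_x)_{x\in E\cup V}\in[0,1]^{E\cup V}$ (one weight $p_{uv}$ per edge $uv\in E$ and one weight $p_u$ per vertex $u\in V$), define edge probabilities on $G^\pm$ by $p_{u_+v_+}=p_{u_-v_-}:=p_{uv}$ for $uv\in E$ and $p_{u_+u_-}:=p_u$ for $u\in V$. Independent bond percolation: let $(\mathcal{Z}_e)_{e\in E^\pm}$ be independent $\{0,1\}$-valued random variables with $\mathbb{P}_{p_G}(\mathcal{Z}_e=1)=p_e$; the edge $e$ is open if $\mathcal{Z}_e=1$ and closed if $\mathcal{Z}_e=0$. For $x,y\in V^\pm$, $x\leftrightarrow y$ is the event that $x$ and $y$ are joined by a (possibly trivial) path of finitely many open edges of $G^\pm$. For $p\in[0,1]$ and $H\subset V$, $\mathbb{P}_{p,H}$ denotes $\mathbb{P}_{p_G}$ for the weights $p_{uv}:=p$ for all $uv\in E$, $p_u:=1$ for all $u\in H$, and $p_u:=0$ for all $u\in V\setminus H$. A finite graph $G=(V,E)$ has the bunkbed property (B2) if for all $p\in[0,1]$, all $H\subset V$ and all $v,w\in V$: $\mathbb{P}_{p,H}(v_-\leftrightarrow w_-)\ge\mathbb{P}_{p,H}(v_-\leftrightarrow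 w_+)$. *)

theory Defs
  imports "HOL-Probability.Probability" "HOL-Probability.Product_PMF" "HOL-Library.Ramsey"
begin

text \<open>A graph is given by its vertex set \<open>V\<close> and its edge set \<open>E\<close>, whose elements are
  two-element subsets of \<open>V\<close>.\<close>

definition finite_graph :: "'a set \<Rightarrow> 'a set set \<Rightarrow> bool" where
  "finite_graph V E \<longleftrightarrow> finite V \<and> E \<subseteq> nsets V 2"

definition is_complete_graph :: "'a set \<Rightarrow> 'a set set \<Rightarrow> bool" where
  "is_complete_graph V E \<longleftrightarrow> E = nsets V 2"

definition is_subgraph :: "'a set \<Rightarrow> 'a set set \<Rightarrow> 'a set \<Rightarrow> 'a set set \<Rightarrow> bool" where
  "is_subgraph U F V E \<longleftrightarrow> U \<subseteq> V \<and> F \<subseteq> E \<and> F \<subseteq> nsets U 2"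

definition complete_bipartite_graph :: "'a set \<Rightarrow> 'a set set \<Rightarrow> bool" where
  "complete_bipartite_graph V E \<longleftrightarrow>
    (\<exists>A B. V = A \<union> B \<and> A \<inter> B = {} \<and> E = {{a, b} |a b. a \<in> A \<and> b \<in> B})"

datatype layer = Plus | Minus

definition bunkbed_verts :: "'a set \<Rightarrow> ('a \<times> layer) set" where
  "bunkbed_verts V = V \<times> {Plus, Minus}"

definition bunkbed_edges :: "'a set \<Rightarrow> 'a set set \<Rightarrow> ('a \<times> layer) set set" where
  "bunkbed_edges V E =
     {{(u, s), (v, s)} |u v s. {u, v} \<in> E} \<union> {{(u, Plus), (u, Minus)} |u. u \<in> V}"

text \<open>The weights on \<open>E \<union> V\<close> are a pair of functions, \<open>pE\<close> on edges and \<open>pV\<close> on vertices.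
  Projecting an edge of the bunkbed graph to the first components gives the underlying
  edge \<open>{u, v}\<close> for a horizontal edge, and a singleton \<open>{u}\<close> for a vertical edge;
  see the two lemmas below.\<close>

definition bunkbed_weight :: "('a set \<Rightarrow> real) \<Rightarrow> ('a \<Rightarrow> real) \<Rightarrow> ('a \<times> layer) set \<Rightarrow> real" where
  "bunkbed_weight pE pV e =
     (if is_singleton (fst ` e) then pV (the_elem (fst ` e)) else pE (fst ` e))"

lemma bunkbed_weight_horizontal:
  "u \<noteq> v \<Longrightarrow> bunkbed_weight pE pV {(u, s), (v, s)} = pE {u, v}"
  by (auto simp: bunkbed_weight_def is_singleton_def)

lemma bunkbed_weight_vertical:
  "bunkbed_weight pE pV {(u, Plus), (u, Minus)} = pV u"
  by (simp add: bunkbed_weight_def)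

lemma bunkbed_finite_graph:
  assumes "finite_graph V E"
  shows "finite_graph (bunkbed_verts V) (bunkbed_edges V E)"
proof -
  have "u \<in> V \<and> v \<in> V \<and> u \<noteq> v" if "{u, v} \<in> E" for u v
  proof -
    have "{u, v} \<in> nsets V 2"
      using that assms unfolding finite_graph_def by blast
    then show ?thesis
      by (auto simp: nsets_def card_insert_if split: if_splits)
  qed
  moreover have "s \<in> {Plus, Minus}" for s
    by (cases s) auto
  ultimately show ?thesis
    using assms unfolding finite_graph_def bunkbed_verts_def bunkbed_edges_def
    by (auto simp: nsets_def card_insert_if)
qed

text \<open>A configuration assigns to each edge whether it is open; under this law the edges of
  the bunkbed graph are independent, and \<open>e\<close> is open with probability
  \<open>bunkbed_weight pE pV e\<close>. Weights are meant to lie in \<open>[0,1]\<close>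
  (\<^const>\<open>bernoulli_pmf\<close> truncates to that interval).\<close>

definition percolation ::
  "'a set \<Rightarrow> 'a set set \<Rightarrow> ('a set \<Rightarrow> real) \<Rightarrow> ('a \<Rightarrow> real) \<Rightarrow> (('a \<times> layer) set \<Rightarrow> bool) pmf" where
  "percolation V E pE pV =
     Pi_pmf (bunkbed_edges V E) False (\<lambda>e. bernoulli_pmf (bunkbed_weight pE pV e))"

definition connected_in ::
  "'a set \<Rightarrow> 'a set set \<Rightarrow> (('a \<times> layer) set \<Rightarrow> bool) \<Rightarrow> 'a \<times> layer \<Rightarrow> 'a \<times> layer \<Rightarrow> bool" where
  "connected_in V E \<omega> = (\<lambda>x y. {x, y} \<in> bunkbed_edges V E \<and> \<omega> {x, y})\<^sup>*\<^sup>*"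

definition conn_prob ::
  "'a set \<Rightarrow> 'a set set \<Rightarrow> ('a set \<Rightarrow> real) \<Rightarrow> ('a \<Rightarrow> real) \<Rightarrow> 'a \<times> layer \<Rightarrow> 'a \<times> layer \<Rightarrow> real" where
  "conn_prob V E pE pV x y =
     measure_pmf.prob (percolation V E pE pV) {\<omega>. connected_in V E \<omega> x y}"

definition bunkbed_property_B2 :: "'a set \<Rightarrow> 'a set set \<Rightarrow> bool" where
  "bunkbed_property_B2 V E \<longleftrightarrow>
     (\<forall>p\<in>{0..1}. \<forall>H\<subseteq>V. \<forall>v\<in>V. \<forall>w\<in>V.
        conn_prob V E (\<lambda>_. p) (\<lambda>u. if u \<in> H then 1 else 0) (v, Minus) (w, Minus)
        \<ge> conn_prob V E (\<lambda>_. p) (\<lambda>u. if u \<in> H then 1 else 0) (v, Minus) (w, Plus))"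

end

theory Submission
  imports Defs
begin

text \<open>
  Write \<open>P(x ~ y)\<close> for the probability that \<open>x\<close> and \<open>y\<close> are connected. If \<open>v\<close> or \<open>w\<close> lies in
  \<open>H\<close>, its two copies are connected, and exchanging the layers shows that the two probabilities
  agree. So let \<open>v \<noteq> w\<close> lie outside \<open>H\<close>. By the same symmetry, twice the difference of the two
  probabilities is
  \<open>P(v\<^sub>- ~ w\<^sub>-) + P(v\<^sub>+ ~ w\<^sub>+) - P(v\<^sub>- ~ w\<^sub>+) - P(v\<^sub>+ ~ w\<^sub>-)\<close>.
  In each of two situations, this expression is handled by conditioning on the configuration away
  from the vertices in question, whose connected components are called cells.

  \<^item> \<open>v\<close> and \<open>w\<close> are in the same class. Condition on the configuration away from the four copies
    of \<open>v\<close> and \<open>w\<close>. Each cell is hit by a random subset of these four vertices, independently of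
    the other cells, and \<open>v\<^sub>-\<close> hits a cell with the same probability as \<open>w\<^sub>-\<close>, \<open>v\<^sub>+\<close> with the same
    probability as \<open>w\<^sub>+\<close>. The expression is a combination of probabilities that certain of the four
    vertices are separated, and each of these is a product over the cells, up to a factor for the
    edges between copies of \<open>v\<close> and \<open>w\<close> in the same layer. The arithmetic-geometric mean
    inequality shows that the combination is nonnegative (\<open>twin_inequality\<close>). Here the structure of
    the rest of the graph plays no role.

  \<^item> \<open>v\<close> is in \<open>V1\<close> and \<open>w\<close> in \<open>V2\<close>. The neighbours of \<open>v\<close> are the vertices of \<open>V2\<close>, all with the
    same edge weight. Condition on the configuration away from \<open>v\<^sub>-\<close> and \<open>v\<^sub>+\<close>. If a cell contains
    more lower than upper copies of vertices in \<open>V2\<close>, then \<open>v\<^sub>-\<close> is at least as likely to reach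
    it as \<open>v\<^sub>+\<close> is, and vice versa. Hence the sum of the expression over all \<open>w\<close> in \<open>V2\<close> is nonnegative
    (\<open>neighbour_average\<close>). The terms with \<open>w \<in> H\<close> vanish, and the others are equal to each other
    by symmetry.

  Both arguments cover all weights in \<open>[0,1]\<close>. This gives property (B2) for complete bipartite
  graphs (weight \<open>0\<close> within \<open>V2\<close>) and for complete graphs without the edges of a complete
  subgraph on \<open>V1\<close> (equal weights within \<open>V2\<close> and between the classes).
\<close>

section \<open>Expectations over random subsets\<close>

text \<open>The expectation of \<open>f A\<close> when \<open>A\<close> is a random subset of the finite set \<open>S\<close> that
  contains each \<open>e\<close> independently with probability \<open>r e\<close>, written as a finite sum.\<close>

definition rexp :: "'e set \<Rightarrow> ('e \<Rightarrow> real) \<Rightarrow> ('e set \<Rightarrow> real) \<Rightarrow> real" where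
  "rexp S r f = (\<Sum>A\<in>Pow S. (\<Prod>e\<in>A. r e) * (\<Prod>e\<in>S - A. 1 - r e) * f A)"

lemma rexp_empty [simp]: "rexp {} r f = f {}"
  by (simp add: rexp_def)

lemma rexp_cong:
  assumes "S = T" "\<And>e. e \<in> S \<Longrightarrow> r e = q e" "\<And>A. A \<subseteq> S \<Longrightarrow> f A = g A"
  shows "rexp S r f = rexp T q g"
proof -
  have "(\<Prod>e\<in>A. r e) * (\<Prod>e\<in>S - A. 1 - r e) * f A
      = (\<Prod>e\<in>A. q e) * (\<Prod>e\<in>S - A. 1 - q e) * g A" if "A \<in> Pow S" for A
  proof -
    have "(\<Prod>e\<in>A. r e) = (\<Prod>e\<in>A. q e)" "(\<Prod>e\<in>S - A. 1 - r e) = (\<Prod>e\<in>S - A. 1 - q e)"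
      using that assms(2) by (auto intro!: prod.cong)
    then show ?thesis using that assms(3) by simp
  qed
  then show ?thesis unfolding rexp_def assms(1)[symmetric] by (rule sum.cong[OF refl])
qed

lemma rexp_insert:
  assumes "finite S" "x \<notin> S"
  shows "rexp (insert x S) r f
    = r x * rexp S r (\<lambda>A. f (insert x A)) + (1 - r x) * rexp S r f"
proof -
  let ?w = "\<lambda>A. (\<Prod>e\<in>A. r e) * (\<Prod>e\<in>insert x S - A. 1 - r e) * f A"
  have disj: "Pow S \<inter> insert x ` Pow S = {}"
    using assms by auto
  have inj: "inj_on (insert x) (Pow S)"
    using assms by (intro inj_onI) (auto simp: insert_ident dest: subsetD)
  have "rexp (insert x S) r f = sum ?w (Pow S) + sum ?w (insert x ` Pow S)"
    unfolding rexp_def Pow_insert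
    by (rule sum.union_disjoint) (use assms disj in auto)
  moreover have "sum ?w (Pow S) = (1 - r x) * rexp S r f"
    unfolding rexp_def sum_distrib_left
  proof (rule sum.cong[OF refl])
    fix A assume A: "A \<in> Pow S"
    then have "insert x S - A = insert x (S - A)" using assms by auto
    then show "?w A = (1 - r x) * ((\<Prod>e\<in>A. r e) * (\<Prod>e\<in>S - A. 1 - r e) * f A)"
      using assms by simp
  qed
  moreover have "sum ?w (insert x ` Pow S) = r x * rexp S r (\<lambda>A. f (insert x A))"
    unfolding rexp_def sum_distrib_left sum.reindex[OF inj] o_def
  proof (rule sum.cong[OF refl])
    fix A assume A: "A \<in> Pow S"
    then have "insert x S - insert x A = S - A" "x \<notin> A" "finite A"
      using assms finite_subset by auto
    then show "?w (insert x A)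
        = r x * ((\<Prod>e\<in>A. r e) * (\<Prod>e\<in>S - A. 1 - r e) * f (insert x A))"
      by simp
  qed
  ultimately show ?thesis by simp
qed

lemma rexp_add: "rexp S r (\<lambda>A. f A + g A) = rexp S r f + rexp S r g"
  by (simp add: rexp_def distrib_left sum.distrib)

lemma rexp_diff: "rexp S r (\<lambda>A. f A - g A) = rexp S r f - rexp S r g"
  by (simp add: rexp_def right_diff_distrib sum_subtractf)

lemma rexp_cmult: "rexp S r (\<lambda>A. c * f A) = c * rexp S r f"
  by (simp add: rexp_def sum_distrib_left mult_ac)

lemma rexp_multc: "rexp S r (\<lambda>A. f A * c) = rexp S r f * c"
  by (simp add: rexp_def sum_distrib_left mult_ac)

lemma rexp_sum: "rexp S r (\<lambda>A. \<Sum>i\<in>I. f i A) = (\<Sum>i\<in>I. rexp S r (f i))"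
  unfolding rexp_def sum_distrib_left by (rule sum.swap)

lemma rexp_const: "finite S \<Longrightarrow> rexp S r (\<lambda>_. c) = c"
  by (induction S rule: finite_induct) (auto simp: rexp_insert algebra_simps)

lemma rexp_mono:
  assumes "\<And>e. e \<in> S \<Longrightarrow> 0 \<le> r e \<and> r e \<le> 1" "\<And>A. A \<subseteq> S \<Longrightarrow> f A \<le> g A"
  shows "rexp S r f \<le> rexp S r g"
  unfolding rexp_def
proof (rule sum_mono)
  fix A assume A: "A \<in> Pow S"
  have "0 \<le> (\<Prod>e\<in>A. r e)" "0 \<le> (\<Prod>e\<in>S - A. 1 - r e)"
    using A assms(1) by (auto intro!: prod_nonneg)
  then show "(\<Prod>e\<in>A. r e) * (\<Prod>e\<in>S - A. 1 - r e) * f A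
      \<le> (\<Prod>e\<in>A. r e) * (\<Prod>e\<in>S - A. 1 - r e) * g A"
    using assms(2) A by (intro mult_left_mono) auto
qed

lemma rexp_nonneg:
  assumes "finite S" "\<And>e. e \<in> S \<Longrightarrow> 0 \<le> r e \<and> r e \<le> 1" "\<And>A. A \<subseteq> S \<Longrightarrow> 0 \<le> f A"
  shows "0 \<le> rexp S r f"
  using rexp_mono[of S r "\<lambda>_. 0" f] assms rexp_const[of S r 0] by simp

text \<open>Disjoint parts of the ground set are independent.\<close>

lemma rexp_union:
  assumes "finite S" "finite T" "S \<inter> T = {}"
  shows "rexp (S \<union> T) r f = rexp S r (\<lambda>A. rexp T r (\<lambda>B. f (A \<union> B)))"
  using assms
proof (induction S arbitrary: f rule: finite_induct)
  case (insert x S)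
  then show ?case by (simp add: rexp_insert)
qed simp

lemma rexp_prod:
  assumes "finite C" "\<And>c. c \<in> C \<Longrightarrow> finite (S c)"
    "\<And>c d. c \<in> C \<Longrightarrow> d \<in> C \<Longrightarrow> c \<noteq> d \<Longrightarrow> S c \<inter> S d = {}"
  shows "rexp (\<Union>c\<in>C. S c) r (\<lambda>B. \<Prod>c\<in>C. g c (B \<inter> S c)) = (\<Prod>c\<in>C. rexp (S c) r (g c))"
  using assms
proof (induction C rule: finite_induct)
  case (insert c C)
  let ?U = "\<Union>d\<in>C. S d"
  have disj: "S c \<inter> ?U = {}"
    using insert by blast
  have 1: "(\<Prod>d\<in>insert c C. g d ((A \<union> B) \<inter> S d)) = g c A * (\<Prod>d\<in>C. g d (B \<inter> S d))"
    if "A \<subseteq> S c" "B \<subseteq> ?U" for A B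
  proof -
    have "(A \<union> B) \<inter> S c = A" using that disj by blast
    moreover have "(A \<union> B) \<inter> S d = B \<inter> S d" if "d \<in> C" for d
      using \<open>A \<subseteq> S c\<close> that disj by blast
    ultimately show ?thesis using insert by simp
  qed
  have "rexp (S c \<union> ?U) r (\<lambda>B. \<Prod>c\<in>insert c C. g c (B \<inter> S c))
     = rexp (S c) r (\<lambda>A. rexp ?U r (\<lambda>B. g c A * (\<Prod>d\<in>C. g d (B \<inter> S d))))"
    using insert.prems insert.hyps disj 1 by (subst rexp_union) (auto intro!: rexp_cong)
  also have "\<dots> = rexp (S c) r (g c) * (\<Prod>d\<in>C. rexp (S d) r (g d))"
    using insert by (simp add: rexp_cmult rexp_multc)
  finally show ?case using insert by simp
qed simp

lemma rexp_avoid: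
  assumes "finite S"
  shows "rexp S r (\<lambda>A. of_bool (A \<inter> F = {})) = (\<Prod>e\<in>S \<inter> F. 1 - r e)"
  using assms
proof (induction S rule: finite_induct)
  case (insert x S)
  then show ?case
    by (cases "x \<in> F") (simp_all add: rexp_insert rexp_const flip: distrib_right)
qed simp

lemma rexp_if_empty:
  assumes "finite S"
  shows "rexp S r (\<lambda>A. if A = {} then x else y)
    = (\<Prod>e\<in>S. 1 - r e) * x + (1 - (\<Prod>e\<in>S. 1 - r e)) * y"
  using assms
proof (induction S rule: finite_induct)
  case (insert z S)
  then show ?case
    by (simp add: rexp_insert rexp_const insert.IH) (simp add: algebra_simps)
qed simp

text \<open>Grouping: if the ground set splits into blocks \<open>S i\<close>, then the set of blocks that are
  met is again a random set with independent membership.\<close>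

lemma rexp_hits:
  assumes "finite W" "\<And>i. i \<in> W \<Longrightarrow> finite (S i)"
    "\<And>i j. i \<in> W \<Longrightarrow> j \<in> W \<Longrightarrow> i \<noteq> j \<Longrightarrow> S i \<inter> S j = {}"
  shows "rexp (\<Union>i\<in>W. S i) r (\<lambda>B. g {i \<in> W. B \<inter> S i \<noteq> {}})
    = rexp W (\<lambda>i. 1 - (\<Prod>e\<in>S i. 1 - r e)) g"
  using assms
proof (induction W arbitrary: g rule: finite_induct)
  case (insert i W)
  let ?U = "\<Union>j\<in>W. S j" and ?q = "\<lambda>i. 1 - (\<Prod>e\<in>S i. 1 - r e)"
  have disj: "S i \<inter> ?U = {}" using insert by blast
  have 1: "{j \<in> insert i W. (A \<union> B) \<inter> S j \<noteq> {}}
      = (if A = {} then {j \<in> W. B \<inter> S j \<noteq> {}} else insert i {j \<in> W. B \<inter> S j \<noteq> {}})"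
    if "A \<subseteq> S i" "B \<subseteq> ?U" for A B
  proof -
    have "(A \<union> B) \<inter> S i = A" using that disj by blast
    moreover have "(A \<union> B) \<inter> S d = B \<inter> S d" if "d \<in> W" for d
      using \<open>A \<subseteq> S i\<close> that disj by blast
    ultimately show ?thesis using insert(2) by auto
  qed
  have IH: "rexp ?U r (\<lambda>B. g {j \<in> W. B \<inter> S j \<noteq> {}}) = rexp W ?q g" for g
    using insert by simp
  have "rexp (S i \<union> ?U) r (\<lambda>B. g {j \<in> insert i W. B \<inter> S j \<noteq> {}})
    = rexp (S i) r (\<lambda>A. rexp ?U r (\<lambda>B.
        if A = {} then g {j \<in> W. B \<inter> S j \<noteq> {}} else g (insert i {j \<in> W. B \<inter> S j \<noteq> {}})))"
    using insert.prems insert.hyps disj 1 by (subst rexp_union) (auto intro!: rexp_cong)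
  also have "\<dots> = rexp (S i) r (\<lambda>A. if A = {} then rexp W ?q g
      else rexp W ?q (\<lambda>K. g (insert i K)))"
    by (intro rexp_cong) (auto simp: IH IH[of "\<lambda>K. g (insert i K)"])
  also have "\<dots> = rexp (insert i W) ?q g"
    using insert by (simp add: rexp_if_empty rexp_insert)
  finally show ?case by simp
qed simp

lemma rexp_reindex:
  assumes "inj_on h S"
  shows "rexp (h ` S) r f = rexp S (r \<circ> h) (\<lambda>A. f (h ` A))"
proof -
  have inj: "inj_on ((`) h) (Pow S)"
    using assms by (simp add: inj_on_image_Pow)
  have "rexp (h ` S) r f = (\<Sum>A\<in>Pow S. (\<Prod>e\<in>h ` A. r e) * (\<Prod>e\<in>h ` S - h ` A. 1 - r e) * f (h ` A))"
    unfolding rexp_def image_Pow_surj[OF refl, symmetric] by (subst sum.reindex[OF inj]) simp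
  also have "\<dots> = rexp S (r \<circ> h) (\<lambda>A. f (h ` A))"
    unfolding rexp_def
  proof (rule sum.cong[OF refl])
    fix A assume A: "A \<in> Pow S"
    then have "h ` S - h ` A = h ` (S - A)" "inj_on h A" "inj_on h (S - A)"
      using assms by (auto simp: inj_on_def)
    then show "(\<Prod>e\<in>h ` A. r e) * (\<Prod>e\<in>h ` S - h ` A. 1 - r e) * f (h ` A)
      = (\<Prod>e\<in>A. (r \<circ> h) e) * (\<Prod>e\<in>S - A. 1 - (r \<circ> h) e) * f (h ` A)"
      by (simp add: prod.reindex)
  qed
  finally show ?thesis .
qed

text \<open>Elements of weight \<open>1\<close> are almost surely present, those of weight \<open>0\<close> almost surely
  absent.\<close>

lemma rexp_weight_one:
  assumes "finite S" "e \<in> S" "r e = 1" "\<And>A. A \<subseteq> S \<Longrightarrow> e \<in> A \<Longrightarrow> f A = g A"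
  shows "rexp S r f = rexp S r g"
proof -
  have "f (insert e A) = g (insert e A)" if "A \<subseteq> S - {e}" for A
    using that assms(2) by (intro assms(4)) auto
  then have "rexp (insert e (S - {e})) r f = rexp (insert e (S - {e})) r g"
    using assms by (subst (1 2) rexp_insert) (auto intro!: rexp_cong)
  then show ?thesis using assms(2) by (simp add: insert_absorb)
qed

lemma rexp_weight_zero:
  assumes "finite T" "S \<subseteq> T" "\<And>e. e \<in> T - S \<Longrightarrow> r e = 0"
  shows "rexp T r f = rexp S r f"
proof -
  have "rexp (U \<union> S) r f = rexp S r f" if "finite U" "U \<subseteq> T - S" for U
    using that
  proof (induction U rule: finite_induct)
    case (insert x U)
    then show ?case
      using assms finite_subset[OF assms(2,1)] by (auto simp: rexp_insert)
  qed simp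
  from this[of "T - S"] assms show ?thesis by (simp add: Un_absorb2)
qed

lemma prob_Pi_pmf_eq_rexp:
  assumes "finite S" "\<And>e. e \<in> S \<Longrightarrow> 0 \<le> r e \<and> r e \<le> 1"
  shows "measure_pmf.prob (Pi_pmf S False (\<lambda>e. bernoulli_pmf (r e))) {\<omega>. Q \<omega>}
    = rexp S r (\<lambda>A. of_bool (Q (\<lambda>e. e \<in> A)))"
proof -
  let ?M = "Pi_pmf S False (\<lambda>e. bernoulli_pmf (r e))"
  let ?h = "\<lambda>A e. e \<in> A"
  have inj: "inj_on ?h (Pow S)"
    by (auto simp: inj_on_def fun_eq_iff)
  have sub: "set_pmf ?M \<subseteq> ?h ` Pow S"
  proof
    fix \<omega> assume "\<omega> \<in> set_pmf ?M"
    then have "\<omega> \<in> PiE_dflt S False (\<lambda>e. set_pmf (bernoulli_pmf (r e)))"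
      by (simp add: set_Pi_pmf[OF assms(1)] o_def)
    then have "\<omega> = ?h {e \<in> S. \<omega> e}"
      by (auto simp: PiE_dflt_def fun_eq_iff)
    then show "\<omega> \<in> ?h ` Pow S" by blast
  qed
  have pmf: "pmf ?M (?h A) = (\<Prod>e\<in>A. r e) * (\<Prod>e\<in>S - A. 1 - r e)" if "A \<in> Pow S" for A
  proof -
    have "pmf ?M (?h A) = (\<Prod>e\<in>S. pmf (bernoulli_pmf (r e)) (e \<in> A))"
      using that assms(1) by (subst pmf_Pi') auto
    also have "\<dots> = (\<Prod>e\<in>S. if e \<in> A then r e else 1 - r e)"
      using assms(2) by (intro prod.cong) auto
    also have "\<dots> = (\<Prod>e\<in>S \<inter> A. r e) * (\<Prod>e\<in>S \<inter> - A. 1 - r e)"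
      using assms(1) by (subst prod.If_cases) (auto simp: Collect_mem_eq)
    finally show ?thesis using that by (simp add: Int_absorb1 Diff_eq)
  qed
  have "measure_pmf.prob ?M {\<omega>. Q \<omega>} = (\<integral>\<omega>. of_bool (Q \<omega>) \<partial>measure_pmf ?M)"
  proof -
    have "(\<lambda>\<omega>. of_bool (Q \<omega>) :: real) = indicator {\<omega>. Q \<omega>}"
      by (auto simp: indicator_def)
    then show ?thesis by simp
  qed
  also have "\<dots> = (\<Sum>\<omega>\<in>?h ` Pow S. of_bool (Q \<omega>) * pmf ?M \<omega>)"
    using assms(1) sub by (intro integral_measure_pmf_real) auto
  also have "\<dots> = (\<Sum>A\<in>Pow S. of_bool (Q (?h A)) * pmf ?M (?h A))"
    by (subst sum.reindex[OF inj]) simp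
  also have "\<dots> = rexp S r (\<lambda>A. of_bool (Q (?h A)))"
    unfolding rexp_def by (intro sum.cong) (auto simp: pmf)
  finally show ?thesis .
qed

section \<open>Connection by a set of edges\<close>

text \<open>\<open>linked A x y\<close>: the vertices \<open>x\<close> and \<open>y\<close> are joined by a path all of whose edges lie in
  \<open>A\<close>.\<close>

definition linked :: "'b set set \<Rightarrow> 'b \<Rightarrow> 'b \<Rightarrow> bool" where
  "linked A = (\<lambda>x y. {x, y} \<in> A)\<^sup>*\<^sup>*"

lemma linked_refl [simp]: "linked A x x"
  by (simp add: linked_def)

lemma linked_edge: "{x, y} \<in> A \<Longrightarrow> linked A x y"
  by (auto simp: linked_def)

lemma linked_trans: "linked A x y \<Longrightarrow> linked A y z \<Longrightarrow> linked A x z"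
  by (simp add: linked_def)

lemma linked_sym: "linked A x y \<Longrightarrow> linked A y x"
proof -
  have "symp (\<lambda>x y. {x, y} \<in> A)"
    by (auto simp: symp_def insert_commute)
  then show "linked A x y \<Longrightarrow> linked A y x"
    unfolding linked_def by (meson symp_rtranclp sympD)
qed

lemma linked_commute: "linked A x y \<longleftrightarrow> linked A y x"
  using linked_sym by metis

lemma linked_mono: "A \<subseteq> B \<Longrightarrow> linked A x y \<Longrightarrow> linked B x y"
  unfolding linked_def by (rule rtranclp_mono[THEN predicate2D, rotated]) auto

lemma linked_closed:
  assumes "linked A x y" "x \<in> Z" "\<And>x y. {x, y} \<in> A \<Longrightarrow> x \<in> Z \<Longrightarrow> y \<in> Z"
  shows "y \<in> Z"
  using assms(1) unfolding linked_def
  by (induction rule: rtranclp_induct) (use assms(2,3) in auto)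

lemma linked_image:
  assumes "linked A x y"
  shows "linked ((`) h ` A) (h x) (h y)"
  using assms unfolding linked_def
proof (induction rule: rtranclp_induct)
  case (step y z)
  from step(2) have "h ` {y, z} \<in> (`) h ` A" by (rule imageI)
  then have "{h y, h z} \<in> (`) h ` A" by simp
  with step(3) show ?case by (rule rtranclp.rtrancl_into_rtrancl)
qed simp

lemma linked_image_iff:
  assumes "inj h"
  shows "linked ((`) h ` A) (h x) (h y) \<longleftrightarrow> linked A x y"
proof
  assume "linked ((`) h ` A) (h x) (h y)"
  from linked_image[OF this, of "inv h"] assms
  show "linked A x y" by (simp add: image_image inv_f_f)
qed (rule linked_image)

text \<open>The cells are the connected components that \<open>A\<close> induces on the vertex set \<open>R\<close>.\<close>

definition cell :: "'b set \<Rightarrow> 'b set set \<Rightarrow> 'b \<Rightarrow> 'b set" where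
  "cell R A x = {y \<in> R. linked A x y}"

definition cells :: "'b set \<Rightarrow> 'b set set \<Rightarrow> 'b set set" where
  "cells R A = cell R A ` R"

lemma finite_cells: "finite R \<Longrightarrow> finite (cells R A)"
  by (simp add: cells_def)

lemma cells_subset: "c \<in> cells R A \<Longrightarrow> c \<subseteq> R"
  by (auto simp: cells_def cell_def)

lemma Union_cells: "\<Union>(cells R A) = R"
  by (auto simp: cells_def cell_def)

lemma linked_in_cell: "c \<in> cells R A \<Longrightarrow> x \<in> c \<Longrightarrow> y \<in> c \<Longrightarrow> linked A x y"
  unfolding cells_def cell_def using linked_sym linked_trans by fast

lemma cell_eq: "linked A x y \<Longrightarrow> cell R A x = cell R A y"
  unfolding cell_def using linked_sym linked_trans by fast

lemma cells_disjoint: "c \<in> cells R A \<Longrightarrow> d \<in> cells R A \<Longrightarrow> c \<noteq> d \<Longrightarrow> c \<inter> d = {}"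
proof (rule ccontr)
  assume cd: "c \<in> cells R A" "d \<in> cells R A" "c \<noteq> d" and "c \<inter> d \<noteq> {}"
  then obtain x y z where "c = cell R A x" "d = cell R A y" "linked A x z" "linked A y z"
    by (auto simp: cells_def cell_def)
  then have "c = d" using cell_eq by metis
  with cd show False by blast
qed

lemma cells_unique: "c \<in> cells R A \<Longrightarrow> d \<in> cells R A \<Longrightarrow> x \<in> c \<Longrightarrow> x \<in> d \<Longrightarrow> c = d"
  using cells_disjoint by fastforce

lemma same_cell:
  assumes "x \<in> R" "y \<in> R"
  shows "linked A x y \<longleftrightarrow> (\<exists>c\<in>cells R A. x \<in> c \<and> y \<in> c)"
proof
  assume "linked A x y"
  then have "x \<in> cell R A x" "y \<in> cell R A x" using assms by (auto simp: cell_def)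
  then show "\<exists>c\<in>cells R A. x \<in> c \<and> y \<in> c" using assms unfolding cells_def by blast
next
  assume "\<exists>c\<in>cells R A. x \<in> c \<and> y \<in> c"
  then show "linked A x y" using linked_in_cell by metis
qed

text \<open>\<open>star i X\<close> is the set of possible edges from \<open>i\<close> to the vertices in \<open>X\<close>.\<close>

definition star :: "'b \<Rightarrow> 'b set \<Rightarrow> 'b set set" where
  "star i X = (\<lambda>x. {i, x}) ` X"

lemma finite_star: "finite X \<Longrightarrow> finite (star i X)"
  by (simp add: star_def)

lemma star_Union: "star i (\<Union>C) = (\<Union>c\<in>C. star i c)"
  by (auto simp: star_def)

lemma prod_star:
  assumes "finite X" "i \<notin> X"
  shows "(\<Prod>e\<in>star i X. f e) = (\<Prod>x\<in>X. f {i, x})"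
proof -
  have "inj_on (\<lambda>x. {i, x}) X"
    by (auto simp: inj_on_def doubleton_eq_iff)
  then show ?thesis by (simp add: star_def prod.reindex)
qed

lemma nsets_2_pair: "{x, y} \<in> nsets N 2 \<longleftrightarrow> x \<in> N \<and> y \<in> N \<and> x \<noteq> y"
  by (auto simp: nsets_def card_insert_if)

lemma nsets_Un_2:
  assumes "W \<inter> R = {}"
  shows "nsets (W \<union> R) 2 = nsets R 2 \<union> nsets W 2 \<union> (\<Union>i\<in>W. star i R)"
proof -
  have "e \<in> nsets R 2 \<union> nsets W 2 \<union> (\<Union>i\<in>W. star i R)" if "e \<in> nsets (W \<union> R) 2" for e
  proof -
    from that obtain x y where e: "e = {x, y}" "x \<noteq> y"
      by (auto simp: nsets_def card_2_iff)
    with that have "x \<in> W \<union> R" "y \<in> W \<union> R" by (auto simp: nsets_2_pair)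
    then show ?thesis
      unfolding e using e(2) by (auto simp: nsets_2_pair star_def insert_commute)
  qed
  moreover have "{i, x} \<in> nsets (W \<union> R) 2" if "i \<in> W" "x \<in> R" for i x
    using that assms by (auto simp: nsets_2_pair)
  moreover have "nsets R 2 \<subseteq> nsets (W \<union> R) 2" "nsets W 2 \<subseteq> nsets (W \<union> R) 2"
    by (auto simp: nsets_def)
  ultimately show ?thesis by (auto simp: star_def)
qed

text \<open>A configuration on \<open>W \<union> R\<close> splits into its part \<open>A\<close> inside \<open>R\<close>, its part \<open>D\<close> inside \<open>W\<close>
  and the edges \<open>B\<close> between them. Then \<open>hits B W c\<close> collects the vertices of \<open>W\<close> with an edge
  of \<open>B\<close> to the cell \<open>c\<close>.\<close>

definition hits :: "'b set set \<Rightarrow> 'b set \<Rightarrow> 'b set \<Rightarrow> 'b set" where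
  "hits B W c = {i \<in> W. B \<inter> star i c \<noteq> {}}"

lemma hits_iff: "i \<in> hits B W c \<longleftrightarrow> i \<in> W \<and> (\<exists>x\<in>c. {i, x} \<in> B)"
  by (auto simp: hits_def star_def)

locale split_configuration =
  fixes W R :: "'b set" and A D B :: "'b set set"
  assumes disjoint: "W \<inter> R = {}"
    and inside: "A \<subseteq> nsets R 2"
    and direct: "D \<subseteq> nsets W 2"
    and between: "B \<subseteq> (\<Union>i\<in>W. star i R)"
begin

lemma edge_cases:
  assumes "{x, y} \<in> A \<union> D \<union> B"
  shows "(x \<in> R \<and> y \<in> R \<and> {x, y} \<in> A) \<or> (x \<in> W \<and> y \<in> W \<and> {x, y} \<in> D)
    \<or> (x \<in> W \<and> y \<in> R \<and> {x, y} \<in> B) \<or> (x \<in> R \<and> y \<in> W \<and> {y, x} \<in> B)"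
proof -
  consider "{x, y} \<in> A" | "{x, y} \<in> D" | "{x, y} \<in> B" using assms by blast
  then show ?thesis
  proof cases
    case 1
    then have "{x, y} \<in> nsets R 2" using inside by blast
    with 1 show ?thesis by (simp add: nsets_2_pair)
  next
    case 2
    then have "{x, y} \<in> nsets W 2" using direct by blast
    with 2 show ?thesis by (simp add: nsets_2_pair)
  next
    case 3
    then obtain i z where "i \<in> W" "z \<in> R" "{x, y} = {i, z}"
      using between by (auto simp: star_def)
    with 3 show ?thesis by (auto simp: doubleton_eq_iff insert_commute)
  qed
qed

lemma linked_hits:
  assumes c: "c \<in> cells R A" and i: "i \<in> hits B W c" and x: "x \<in> c"
  shows "linked (A \<union> D \<union> B) i x"
proof -
  from i obtain y where y: "y \<in> c" "{i, y} \<in> B" by (auto simp: hits_iff)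
  have "linked (A \<union> D \<union> B) i y" using y by (intro linked_edge) auto
  moreover have "linked (A \<union> D \<union> B) y x"
    using linked_in_cell[OF c y(1) x] by (rule linked_mono[rotated]) auto
  ultimately show ?thesis by (rule linked_trans)
qed

text \<open>Vertices of \<open>W\<close> with different colours are never linked if and only if no edge inside \<open>W\<close>
  and no cell joins different colours: in that case the colouring extends to all vertices that
  are linked to \<open>W\<close>.\<close>

lemma separated_iff:
  "(\<forall>i\<in>W. \<forall>j\<in>W. \<tau> i \<noteq> \<tau> j \<longrightarrow> \<not> linked (A \<union> D \<union> B) i j)
   \<longleftrightarrow> (D \<inter> {{i, j} |i j. i \<in> W \<and> j \<in> W \<and> \<tau> i \<noteq> \<tau> j} = {})
     \<and> (\<forall>c\<in>cells R A. \<forall>i\<in>hits B W c. \<forall>j\<in>hits B W c. \<tau> i = \<tau> j)"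
  (is "?L \<longleftrightarrow> ?D \<and> ?C")
proof
  assume L: ?L
  have ?D
  proof (rule ccontr)
    assume "\<not> ?D"
    then obtain i j where "{i, j} \<in> D" "i \<in> W" "j \<in> W" "\<tau> i \<noteq> \<tau> j" by auto
    then show False using L linked_edge[of i j "A \<union> D \<union> B"] by blast
  qed
  moreover have ?C
  proof (intro ballI)
    fix c i j assume *: "c \<in> cells R A" "i \<in> hits B W c" "j \<in> hits B W c"
    then obtain x where "x \<in> c" by (auto simp: hits_iff)
    then have "linked (A \<union> D \<union> B) i j"
      using linked_trans[OF linked_hits[OF *(1,2)] linked_sym[OF linked_hits[OF *(1,3)]]] by blast
    then show "\<tau> i = \<tau> j" using L * by (auto simp: hits_iff)
  qed
  ultimately show "?D \<and> ?C" by blast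
next
  assume DC: "?D \<and> ?C"
  show ?L
  proof (intro ballI impI notI)
    fix i j assume ij: "i \<in> W" "j \<in> W" "\<tau> i \<noteq> \<tau> j" and l: "linked (A \<union> D \<union> B) i j"
    let ?Z = "{k \<in> W. \<tau> k = \<tau> i}
      \<union> {x \<in> R. \<exists>c\<in>cells R A. x \<in> c \<and> (\<exists>k\<in>hits B W c. \<tau> k = \<tau> i)}"
    have "j \<in> ?Z"
    proof (rule linked_closed[OF l])
      fix x y assume e: "{x, y} \<in> A \<union> D \<union> B" and x: "x \<in> ?Z"
      from edge_cases[OF e] consider
        (R) "x \<in> R" "y \<in> R" "{x, y} \<in> A" | (W) "x \<in> W" "y \<in> W" "{x, y} \<in> D"
        | (WR) "x \<in> W" "y \<in> R" "{x, y} \<in> B" | (RW) "x \<in> R" "y \<in> W" "{y, x} \<in> B" by blast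
      then show "y \<in> ?Z"
      proof cases
        case R
        with x disjoint obtain c k where c: "c \<in> cells R A" "x \<in> c" "k \<in> hits B W c" "\<tau> k = \<tau> i"
          by blast
        obtain d where "d \<in> cells R A" "x \<in> d" "y \<in> d"
          using same_cell[OF R(1,2)] linked_edge[OF R(3)] by blast
        then have "y \<in> c" using c(1,2) cells_unique by metis
        with R c show ?thesis by blast
      next
        case W
        then have "\<tau> x = \<tau> y" using DC by blast
        with W x disjoint show ?thesis by auto
      next
        case WR
        then have "\<tau> x = \<tau> i" using x disjoint by auto
        moreover obtain c where "c \<in> cells R A" "y \<in> c" using WR(2) Union_cells[of R A] by blast
        moreover then have "x \<in> hits B W c" using WR by (auto simp: hits_iff)
        ultimately show ?thesis using WR by blast
      next
        case RW
        with x disjoint obtain c k where c: "c \<in> cells R A" "x \<in> c" "k \<in> hits B W c" "\<tau> k = \<tau> i"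
          by blast
        moreover from c RW have "y \<in> hits B W c" by (auto simp: hits_iff)
        ultimately have "\<tau> y = \<tau> i" using DC by metis
        with RW show ?thesis by blast
      qed
    qed (use ij in simp)
    then show False using ij disjoint by auto
  qed
qed

text \<open>A vertex \<open>i\<close> of \<open>W\<close> that is linked to no other vertex of \<open>W\<close> reaches exactly the cells that
  it hits.\<close>

lemma linked_cell_iff:
  assumes i: "i \<in> W" and alone: "\<And>j. j \<in> W \<Longrightarrow> j \<noteq> i \<Longrightarrow> \<not> linked (A \<union> D \<union> B) i j"
    and c: "c \<in> cells R A" "x \<in> c"
  shows "linked (A \<union> D \<union> B) i x \<longleftrightarrow> i \<in> hits B W c"
proof
  assume l: "linked (A \<union> D \<union> B) i x"
  let ?Z = "{i} \<union> {y \<in> R. \<exists>d\<in>cells R A. y \<in> d \<and> i \<in> hits B W d}"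
  let ?Y = "{y. linked (A \<union> D \<union> B) i y}"
  have "x \<in> ?Z \<inter> ?Y"
  proof (rule linked_closed[OF l])
    fix y z assume e: "{y, z} \<in> A \<union> D \<union> B" and y: "y \<in> ?Z \<inter> ?Y"
    have z: "z \<in> ?Y" using y linked_trans[OF _ linked_edge[OF e]] by blast
    from edge_cases[OF e] consider
      (R) "y \<in> R" "z \<in> R" "{y, z} \<in> A" | (W) "z \<in> W"
      | (WR) "y \<in> W" "z \<in> R" "{y, z} \<in> B" by blast
    then show "z \<in> ?Z \<inter> ?Y"
    proof cases
      case R
      with y i disjoint obtain d where d: "d \<in> cells R A" "y \<in> d" "i \<in> hits B W d" by blast
      obtain d' where "d' \<in> cells R A" "y \<in> d'" "z \<in> d'"
        using same_cell[OF R(1,2)] linked_edge[OF R(3)] by blast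
      then have "z \<in> d" using d cells_unique by metis
      with R d z show ?thesis by blast
    next
      case W
      with z alone have "z = i" by blast
      with z show ?thesis by simp
    next
      case WR
      then have "y = i" using y disjoint by auto
      moreover obtain d where "d \<in> cells R A" "z \<in> d" using WR(2) Union_cells[of R A] by blast
      moreover then have "y \<in> hits B W d" using WR by (auto simp: hits_iff)
      ultimately show ?thesis using WR z by blast
    qed
  qed simp
  moreover have "x \<in> R" using c cells_subset by blast
  ultimately obtain d where "d \<in> cells R A" "x \<in> d" "i \<in> hits B W d"
    using i disjoint by blast
  then show "i \<in> hits B W c" using c cells_unique by metis
qed (rule linked_hits[OF c(1) _ c(2)])

end

section \<open>Random edges on a finite vertex set\<close>

text \<open>The probability that \<open>x\<close> and \<open>y\<close> are linked when each pair \<open>e\<close> of vertices in \<open>N\<close> is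
  independently an open edge with probability \<open>r e\<close>.\<close>

definition link_prob :: "'b set \<Rightarrow> ('b set \<Rightarrow> real) \<Rightarrow> 'b \<Rightarrow> 'b \<Rightarrow> real" where
  "link_prob N r x y = rexp (nsets N 2) r (\<lambda>A. of_bool (linked A x y))"

lemma finite_nsets_2: "finite N \<Longrightarrow> finite (nsets N 2)"
  by (rule finite_imp_finite_nsets)

lemma link_prob_le_one:
  assumes "finite N" "\<And>e. e \<in> nsets N 2 \<Longrightarrow> 0 \<le> r e \<and> r e \<le> 1"
  shows "link_prob N r x y \<le> 1"
  using rexp_mono[of "nsets N 2" r "\<lambda>A. of_bool (linked A x y)" "\<lambda>_. 1"] assms
  by (simp add: link_prob_def rexp_const finite_nsets_2)

lemma link_prob_refl [simp]: "finite N \<Longrightarrow> link_prob N r x x = 1"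
  by (simp add: link_prob_def rexp_const finite_nsets_2)

lemma link_prob_commute: "link_prob N r x y = link_prob N r y x"
  by (simp add: link_prob_def linked_commute)

lemma link_prob_sure_edge:
  assumes "finite N" "x \<in> N" "y \<in> N" "r {x, y} = 1"
  shows "link_prob N r x z = link_prob N r y z"
proof (cases "x = y")
  case False
  show ?thesis
    unfolding link_prob_def
  proof (rule rexp_weight_one[of _ "{x, y}"])
    fix A assume "{x, y} \<in> A"
    then have "linked A x z \<longleftrightarrow> linked A y z"
      using linked_edge linked_sym linked_trans by metis
    then show "of_bool (linked A x z) = (of_bool (linked A y z) :: real)" by simp
  qed (use assms False in \<open>auto simp: nsets_2_pair finite_nsets_2\<close>)
qed simp

lemma link_prob_automorphism:
  assumes "inj h" "h ` N = N" "\<And>e. e \<in> nsets N 2 \<Longrightarrow> r (h ` e) = r e"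
  shows "link_prob N r (h x) (h y) = link_prob N r x y"
proof -
  have inj: "inj_on ((`) h) (nsets N 2)"
    using assms(1) by (auto simp: inj_on_def inj_image_eq_iff)
  have "(`) h ` nsets N 2 = nsets N 2"
  proof
    show "(`) h ` nsets N 2 \<subseteq> nsets N 2"
      using assms(1,2) by (auto simp: nsets_def card_image inj_on_subset)
    show "nsets N 2 \<subseteq> (`) h ` nsets N 2"
    proof
      fix e assume "e \<in> nsets N 2"
      then obtain x y where e: "e = {x, y}" "x \<noteq> y" "x \<in> N" "y \<in> N"
        by (auto simp: nsets_def card_2_iff)
      then obtain x' y' where "x = h x'" "y = h y'" "x' \<in> N" "y' \<in> N"
        using assms(2) by blast
      with e show "e \<in> (`) h ` nsets N 2"
        by (intro image_eqI[of _ _ "{x', y'}"]) (auto simp: nsets_2_pair)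
    qed
  qed
  then have "link_prob N r (h x) (h y)
      = rexp ((`) h ` nsets N 2) r (\<lambda>A. of_bool (linked A (h x) (h y)))"
    by (simp add: link_prob_def)
  also have "\<dots> = link_prob N r x y"
    unfolding rexp_reindex[OF inj] link_prob_def
    by (rule rexp_cong) (simp_all add: assms(3) linked_image_iff[OF assms(1)])
  finally show ?thesis .
qed

lemma rexp_split:
  assumes "finite W" "finite R" "W \<inter> R = {}"
  shows "rexp (nsets (W \<union> R) 2) r f
    = rexp (nsets R 2) r (\<lambda>A. rexp (nsets W 2) r (\<lambda>D.
        rexp (\<Union>i\<in>W. star i R) r (\<lambda>B. f (A \<union> D \<union> B))))"
proof -
  have 1: "nsets R 2 \<inter> nsets W 2 = {}"
    using assms(3) by (auto simp: nsets_def card_2_iff)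
  have 2: "(nsets R 2 \<union> nsets W 2) \<inter> (\<Union>i\<in>W. star i R) = {}"
    using assms(3) by (auto simp: star_def nsets_2_pair)
  have fin: "finite (\<Union>i\<in>W. star i R)"
    using assms by (auto simp: finite_star)
  show ?thesis
    using assms 1 2 fin
    by (simp add: nsets_Un_2 rexp_union finite_nsets_2)
qed

text \<open>\<open>miss r i c\<close> is the probability that no edge from \<open>i\<close> to \<open>c\<close> is open. The sets of vertices of
  \<open>W\<close> that hit the different cells are independent.\<close>

definition miss :: "('b set \<Rightarrow> real) \<Rightarrow> 'b \<Rightarrow> 'b set \<Rightarrow> real" where
  "miss r i c = (\<Prod>x\<in>c. 1 - r {i, x})"

lemma rexp_cells:
  assumes "finite W" "finite R" "W \<inter> R = {}"
  shows "rexp (\<Union>i\<in>W. star i R) r (\<lambda>B. \<Prod>c\<in>cells R A. g c (hits B W c))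
    = (\<Prod>c\<in>cells R A. rexp W (\<lambda>i. 1 - miss r i c) (g c))"
proof -
  let ?S = "\<lambda>c. \<Union>i\<in>W. star i c"
  have eq: "(\<Union>i\<in>W. star i R) = (\<Union>c\<in>cells R A. ?S c)"
    using star_Union[of _ "cells R A"] by (auto simp: Union_cells)
  have cR: "c \<subseteq> R" "finite c" "W \<inter> c = {}" if "c \<in> cells R A" for c
    using cells_subset[OF that] assms finite_subset by auto
  have fin: "finite (?S c)" if "c \<in> cells R A" for c
    using cR[OF that] assms by (auto simp: finite_star)
  have disj: "?S c \<inter> ?S d = {}" if "c \<in> cells R A" "d \<in> cells R A" "c \<noteq> d" for c d
    using cells_disjoint[OF that] cR[OF that(1)] cR[OF that(2)]
    by (auto simp: star_def doubleton_eq_iff)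
  have "(\<lambda>B. \<Prod>c\<in>cells R A. g c (hits B W c)) = (\<lambda>B. \<Prod>c\<in>cells R A. g c (hits (B \<inter> ?S c) W c))"
  proof (intro ext prod.cong refl)
    fix B c
    have "hits B W c = hits (B \<inter> ?S c) W c" by (auto simp: hits_def)
    then show "g c (hits B W c) = g c (hits (B \<inter> ?S c) W c)" by simp
  qed
  then have "rexp (\<Union>i\<in>W. star i R) r (\<lambda>B. \<Prod>c\<in>cells R A. g c (hits B W c))
      = (\<Prod>c\<in>cells R A. rexp (?S c) r (\<lambda>B. g c (hits B W c)))"
    unfolding eq using fin disj finite_cells[OF assms(2)]
    by (simp add: rexp_prod[where g = "\<lambda>c B. g c (hits B W c)"])
  also have "\<dots> = (\<Prod>c\<in>cells R A. rexp W (\<lambda>i. 1 - miss r i c) (g c))"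
  proof (rule prod.cong[OF refl])
    fix c assume c: "c \<in> cells R A"
    have "rexp (?S c) r (\<lambda>B. g c (hits B W c))
        = rexp W (\<lambda>i. 1 - (\<Prod>e\<in>star i c. 1 - r e)) (g c)"
      unfolding hits_def using assms cR[OF c]
      by (intro rexp_hits) (auto simp: finite_star star_def doubleton_eq_iff)
    also have "\<dots> = rexp W (\<lambda>i. 1 - miss r i c) (g c)"
    proof (rule rexp_cong)
      fix i assume "i \<in> W"
      then have "i \<notin> c" using cR(3)[OF c] by blast
      then show "1 - (\<Prod>e\<in>star i c. 1 - r e) = 1 - miss r i c"
        by (simp add: miss_def prod_star[OF cR(2)[OF c]])
    qed simp_all
    finally show "rexp (?S c) r (\<lambda>B. g c (hits B W c)) = rexp W (\<lambda>i. 1 - miss r i c) (g c)" .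
  qed
  finally show ?thesis .
qed

section \<open>Twins\<close>

text \<open>The inequality behind the comparison for twins. Expanding the products over subsets of the
  index set, it is the arithmetic-geometric mean inequality for the products of \<open>u\<^sup>2\<close> over a set and
  of \<open>v\<^sup>2\<close> over its complement, paired with the same products for the complementary set.\<close>

lemma twin_products:
  fixes m u v :: "'c \<Rightarrow> real"
  assumes "finite I" "\<And>c. c \<in> I \<Longrightarrow> 0 \<le> m c \<and> 0 \<le> u c \<and> 0 \<le> v c"
  defines "P \<equiv> \<lambda>f. \<Prod>c\<in>I. m c + f c"
  defines "a \<equiv> P (\<lambda>c. u c * u c + v c * v c)"
    and "bu \<equiv> P (\<lambda>c. u c * u c)" and "bv \<equiv> P (\<lambda>c. v c * v c)"
    and "d \<equiv> P (\<lambda>c. 2 * (u c * v c))" and "e \<equiv> P (\<lambda>c. u c * v c)"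
  shows "bu \<le> a" "bv \<le> a"
    and "2 * d - 2 * e \<le> 2 * a - bu - bv"
proof -
  let ?Q = "\<lambda>I f. \<Prod>c\<in>I. m c + f c"
  let ?a = "\<lambda>I. ?Q I (\<lambda>c. u c * u c + v c * v c)" and ?bu = "\<lambda>I. ?Q I (\<lambda>c. u c * u c)"
    and ?bv = "\<lambda>I. ?Q I (\<lambda>c. v c * v c)" and ?d = "\<lambda>I. ?Q I (\<lambda>c. 2 * (u c * v c))"
    and ?e = "\<lambda>I. ?Q I (\<lambda>c. u c * v c)"
  have sq: "2 * (s * t) \<le> s * s + t * t" for s t :: real
    using sum_squares_bound[of s t] by (simp add: power2_eq_square)
  have le: "?d J \<le> ?a J" "?bu J \<le> ?a J" "?bv J \<le> ?a J" "0 \<le> ?a J" if "J \<subseteq> I" for J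
    using that assms(2) sq
    by (auto intro!: prod_mono prod_nonneg add_nonneg_nonneg mult_nonneg_nonneg)
  then show "bu \<le> a" "bv \<le> a"
    unfolding a_def bu_def bv_def P_def by blast+
  \<comment> \<open>The quadratic inequality for all \<open>x\<close> and \<open>y\<close> makes the induction work: adding a factor to the
    products uses it for \<open>x = u c\<close> and \<open>y = v c\<close>.\<close>
  have "(\<forall>x y. 0 \<le> x \<longrightarrow> 0 \<le> y \<longrightarrow>
          2 * (2 * ?d J - ?e J) * (x * y) \<le> (2 * ?a J - ?bu J) * x\<^sup>2 + (2 * ?a J - ?bv J) * y\<^sup>2)
      \<and> 2 * ?d J - 2 * ?e J \<le> 2 * ?a J - ?bu J - ?bv J" if "J \<subseteq> I" for J
    using finite_subset[OF that assms(1)] that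
  proof (induction J rule: finite_induct)
    case empty
    then show ?case using sq by (simp add: power2_eq_square algebra_simps)
  next
    case (insert c J)
    define A BU BV D E where "A = ?a J" "BU = ?bu J" "BV = ?bv J" "D = ?d J" "E = ?e J"
    define M U V where "M = m c" "U = u c" "V = v c"
    note defs = this A_BU_BV_D_E_def
    have pos: "0 \<le> M" "0 \<le> U" "0 \<le> V" using assms(2) insert.prems by (auto simp: defs)
    have DA: "D \<le> A" "0 \<le> A" using le[of J] insert.prems by (auto simp: defs)
    have IH1: "2 * (2 * D - E) * (x * y) \<le> (2 * A - BU) * x\<^sup>2 + (2 * A - BV) * y\<^sup>2"
      if "0 \<le> x" "0 \<le> y" for x y
      using insert.IH insert.prems that by (auto simp: defs)
    have IH2: "2 * D - 2 * E \<le> 2 * A - BU - BV"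
      using insert.IH insert.prems by (auto simp: defs)
    have step1: "2 * (2 * ((M + 2 * (U * V)) * D) - (M + U * V) * E) * (x * y)
        \<le> (2 * ((M + (U * U + V * V)) * A) - (M + U * U) * BU) * x\<^sup>2
          + (2 * ((M + (U * U + V * V)) * A) - (M + V * V) * BV) * y\<^sup>2"
      if xy: "0 \<le> x" "0 \<le> y" for x y
    proof -
      have 1: "M * (2 * (2 * D - E) * (x * y)) \<le> M * ((2 * A - BU) * x\<^sup>2 + (2 * A - BV) * y\<^sup>2)"
        using IH1[OF xy] pos by (intro mult_left_mono)
      have 2: "2 * (2 * D - E) * ((U * x) * (V * y))
          \<le> (2 * A - BU) * (U * x)\<^sup>2 + (2 * A - BV) * (V * y)\<^sup>2"
        using xy pos by (intro IH1) auto
      have "2 * ((V * x) * (U * y)) \<le> (V * x)\<^sup>2 + (U * y)\<^sup>2"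
        using sum_squares_bound[of "V * x" "U * y"] by simp
      then have "2 * A * (2 * ((V * x) * (U * y))) \<le> 2 * A * ((V * x)\<^sup>2 + (U * y)\<^sup>2)"
        using DA by (intro mult_left_mono) auto
      moreover have "4 * D * ((V * x) * (U * y)) \<le> 4 * A * ((V * x) * (U * y))"
        using DA xy pos by (intro mult_right_mono) auto
      ultimately have 3: "4 * D * ((V * x) * (U * y)) \<le> 2 * A * ((V * x)\<^sup>2 + (U * y)\<^sup>2)"
        by linarith
      from 1 2 3 show ?thesis
        by (simp add: algebra_simps power2_eq_square)
    qed
    have "M * (2 * D - 2 * E) \<le> M * (2 * A - BU - BV)"
      using IH2 pos by (intro mult_left_mono)
    with IH1[OF pos(2,3)]
    have step2: "2 * ((M + 2 * (U * V)) * D) - 2 * ((M + U * V) * E)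
        \<le> 2 * ((M + (U * U + V * V)) * A) - (M + U * U) * BU - (M + V * V) * BV"
      by (simp add: algebra_simps power2_eq_square)
    show ?case
      using insert.hyps step1 step2 by (simp add: defs)
  qed
  from this[of I]
  show "2 * d - 2 * e \<le> 2 * a - bu - bv"
    unfolding a_def bu_def bv_def d_def e_def P_def by blast
qed

lemma prod_of_bool: "finite C \<Longrightarrow> (\<Prod>c\<in>C. of_bool (P c)) = (of_bool (\<forall>c\<in>C. P c) :: real)"
  by (induction C rule: finite_induct) auto

text \<open>The probability, given the configuration \<open>A\<close> on \<open>R\<close>, that no two vertices of \<open>W\<close> with
  different colours are linked.\<close>

lemma separation_probability:
  assumes "finite W" "finite R" "W \<inter> R = {}" "A \<subseteq> nsets R 2"
  shows "rexp (nsets W 2) r (\<lambda>D. rexp (\<Union>i\<in>W. star i R) r (\<lambda>B.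
      of_bool (\<forall>i\<in>W. \<forall>j\<in>W. \<tau> i \<noteq> \<tau> j \<longrightarrow> \<not> linked (A \<union> D \<union> B) i j)))
    = (\<Prod>e\<in>nsets W 2 \<inter> {{i, j} |i j. i \<in> W \<and> j \<in> W \<and> \<tau> i \<noteq> \<tau> j}. 1 - r e)
      * (\<Prod>c\<in>cells R A. rexp W (\<lambda>i. 1 - miss r i c) (\<lambda>K. of_bool (\<forall>i\<in>K. \<forall>j\<in>K. \<tau> i = \<tau> j)))"
proof -
  let ?X = "{{i, j} |i j. i \<in> W \<and> j \<in> W \<and> \<tau> i \<noteq> \<tau> j}"
  let ?m = "\<lambda>K. of_bool (\<forall>i\<in>K. \<forall>j\<in>K. \<tau> i = \<tau> j) :: real"
  have "rexp (nsets W 2) r (\<lambda>D. rexp (\<Union>i\<in>W. star i R) r (\<lambda>B.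
      of_bool (\<forall>i\<in>W. \<forall>j\<in>W. \<tau> i \<noteq> \<tau> j \<longrightarrow> \<not> linked (A \<union> D \<union> B) i j)))
    = rexp (nsets W 2) r (\<lambda>D. rexp (\<Union>i\<in>W. star i R) r (\<lambda>B.
        of_bool (D \<inter> ?X = {}) * (\<Prod>c\<in>cells R A. ?m (hits B W c))))"
  proof (intro rexp_cong refl)
    fix D B assume "D \<subseteq> nsets W 2" "B \<subseteq> (\<Union>i\<in>W. star i R)"
    then interpret split_configuration W R A D B
      using assms by unfold_locales
    have "(\<Prod>c\<in>cells R A. ?m (hits B W c))
        = of_bool (\<forall>c\<in>cells R A. \<forall>i\<in>hits B W c. \<forall>j\<in>hits B W c. \<tau> i = \<tau> j)"
      by (rule prod_of_bool[OF finite_cells[OF assms(2)]])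
    then show "of_bool (\<forall>i\<in>W. \<forall>j\<in>W. \<tau> i \<noteq> \<tau> j \<longrightarrow> \<not> linked (A \<union> D \<union> B) i j)
        = of_bool (D \<inter> ?X = {}) * (\<Prod>c\<in>cells R A. ?m (hits B W c))"
      unfolding separated_iff of_bool_conj by simp
  qed
  also have "\<dots> = (\<Prod>e\<in>nsets W 2 \<inter> ?X. 1 - r e)
      * (\<Prod>c\<in>cells R A. rexp W (\<lambda>i. 1 - miss r i c) ?m)"
    using assms by (simp add: rexp_cmult rexp_multc rexp_cells[where g = "\<lambda>_. ?m"] rexp_avoid
        finite_nsets_2)
  finally show ?thesis .
qed

lemma nsets_4:
  assumes "distinct [v1, v2, v3, v4]"
  shows "nsets {v1, v2, v3, v4} 2
    = {{v1, v3}, {v2, v4}, {v1, v2}, {v1, v4}, {v3, v2}, {v3, v4}}"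
proof -
  have 1: "e \<in> {{v1, v3}, {v2, v4}, {v1, v2}, {v1, v4}, {v3, v2}, {v3, v4}}"
    if "e \<in> nsets {v1, v2, v3, v4} 2" for e
  proof -
    from that obtain x y where e: "e = {x, y}" "x \<noteq> y"
      by (auto simp: nsets_def card_2_iff)
    with that have "x \<in> {v1, v2, v3, v4}" "y \<in> {v1, v2, v3, v4}" by (auto simp: nsets_2_pair)
    then show ?thesis
      using e by (elim insertE emptyE) (simp_all add: doubleton_eq_iff)
  qed
  have 2: "{{v1, v3}, {v2, v4}, {v1, v2}, {v1, v4}, {v3, v2}, {v3, v4}}
      \<subseteq> nsets {v1, v2, v3, v4} 2"
    using assms by (auto simp: nsets_2_pair)
  show ?thesis by (rule subset_antisym[OF subsetI[OF 1] 2])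
qed

text \<open>For an equivalence relation on four points, comparing the pairs \<open>13\<close> and \<open>24\<close> with the
  pairs \<open>14\<close> and \<open>23\<close> amounts to comparing how often the induced partition refines each of six
  partitions.\<close>

lemma four_point_identity:
  assumes "\<And>i j. L i j \<longleftrightarrow> L j i" "\<And>i j k. L i j \<Longrightarrow> L j k \<Longrightarrow> L i k"
    and "distinct [v1, v2, v3, v4]"
  defines "sep \<equiv> \<lambda>\<tau> :: 'b \<Rightarrow> nat. of_bool (\<forall>i\<in>{v1, v2, v3, v4}. \<forall>j\<in>{v1, v2, v3, v4}.
      \<tau> i \<noteq> \<tau> j \<longrightarrow> \<not> L i j) :: real"
  shows "of_bool (L v1 v3) + of_bool (L v2 v4) - of_bool (L v1 v4) - of_bool (L v3 v2)
    = 2 * sep (\<lambda>x. if x = v1 \<or> x = v3 then 0 else 1)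
      - sep (\<lambda>x. if x = v1 \<or> x = v3 then 0 else if x = v2 then 1 else 2)
      - sep (\<lambda>x. if x = v2 \<or> x = v4 then 0 else if x = v1 then 1 else 2)
      - 2 * sep (\<lambda>x. if x = v1 \<or> x = v4 then 0 else 1)
      + sep (\<lambda>x. if x = v1 \<or> x = v4 then 0 else if x = v2 then 1 else 2)
      + sep (\<lambda>x. if x = v3 \<or> x = v2 then 0 else if x = v1 then 1 else 2)"
proof -
  have s: "L v2 v1 = L v1 v2" "L v3 v1 = L v1 v3" "L v4 v1 = L v1 v4" "L v3 v2 = L v2 v3"
    "L v4 v2 = L v2 v4" "L v4 v3 = L v3 v4"
    using assms(1) by blast+
  note t = assms(2)[of v1 v2 v3] assms(2)[of v1 v3 v2] assms(2)[of v2 v1 v3]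
    assms(2)[of v1 v2 v4] assms(2)[of v1 v4 v2] assms(2)[of v2 v1 v4]
    assms(2)[of v1 v3 v4] assms(2)[of v1 v4 v3] assms(2)[of v3 v1 v4]
    assms(2)[of v2 v3 v4] assms(2)[of v2 v4 v3] assms(2)[of v3 v2 v4]
  have "sep (\<lambda>x. if x = v1 \<or> x = v3 then 0 else 1)
      = of_bool (\<not> L v1 v2 \<and> \<not> L v1 v4 \<and> \<not> L v2 v3 \<and> \<not> L v3 v4)"
    "sep (\<lambda>x. if x = v1 \<or> x = v3 then 0 else if x = v2 then 1 else 2)
      = of_bool (\<not> L v1 v2 \<and> \<not> L v1 v4 \<and> \<not> L v2 v3 \<and> \<not> L v3 v4 \<and> \<not> L v2 v4)"
    "sep (\<lambda>x. if x = v2 \<or> x = v4 then 0 else if x = v1 then 1 else 2)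
      = of_bool (\<not> L v1 v2 \<and> \<not> L v1 v4 \<and> \<not> L v2 v3 \<and> \<not> L v3 v4 \<and> \<not> L v1 v3)"
    "sep (\<lambda>x. if x = v1 \<or> x = v4 then 0 else 1)
      = of_bool (\<not> L v1 v2 \<and> \<not> L v1 v3 \<and> \<not> L v2 v4 \<and> \<not> L v3 v4)"
    "sep (\<lambda>x. if x = v1 \<or> x = v4 then 0 else if x = v2 then 1 else 2)
      = of_bool (\<not> L v1 v2 \<and> \<not> L v1 v3 \<and> \<not> L v2 v4 \<and> \<not> L v3 v4 \<and> \<not> L v2 v3)"
    "sep (\<lambda>x. if x = v3 \<or> x = v2 then 0 else if x = v1 then 1 else 2)
      = of_bool (\<not> L v1 v2 \<and> \<not> L v1 v3 \<and> \<not> L v2 v4 \<and> \<not> L v3 v4 \<and> \<not> L v1 v4)"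
    unfolding sep_def using assms(3) by (simp_all add: s) blast+
  moreover
  have bool: "\<forall>a b c d e f. (a \<and> d \<longrightarrow> b) \<and> (b \<and> d \<longrightarrow> a) \<and> (a \<and> b \<longrightarrow> d) \<and> (a \<and> e \<longrightarrow> c)
      \<and> (c \<and> e \<longrightarrow> a) \<and> (a \<and> c \<longrightarrow> e) \<and> (b \<and> f \<longrightarrow> c) \<and> (c \<and> f \<longrightarrow> b) \<and> (b \<and> c \<longrightarrow> f)
      \<and> (d \<and> f \<longrightarrow> e) \<and> (e \<and> f \<longrightarrow> d) \<and> (d \<and> e \<longrightarrow> f) \<longrightarrow>
    of_bool b + of_bool e - of_bool c - of_bool d
      = 2 * of_bool (\<not> a \<and> \<not> c \<and> \<not> d \<and> \<not> f) - of_bool (\<not> a \<and> \<not> c \<and> \<not> d \<and> \<not> f \<and> \<not> e)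
        - of_bool (\<not> a \<and> \<not> c \<and> \<not> d \<and> \<not> f \<and> \<not> b) - 2 * of_bool (\<not> a \<and> \<not> b \<and> \<not> e \<and> \<not> f)
        + of_bool (\<not> a \<and> \<not> b \<and> \<not> e \<and> \<not> f \<and> \<not> d)
        + (of_bool (\<not> a \<and> \<not> b \<and> \<not> e \<and> \<not> f \<and> \<not> c) :: real)"
    unfolding all_bool_eq by simp
  moreover have "of_bool (L v1 v3) + of_bool (L v2 v4) - of_bool (L v1 v4) - of_bool (L v2 v3)
      = 2 * of_bool (\<not> L v1 v2 \<and> \<not> L v1 v4 \<and> \<not> L v2 v3 \<and> \<not> L v3 v4)
        - of_bool (\<not> L v1 v2 \<and> \<not> L v1 v4 \<and> \<not> L v2 v3 \<and> \<not> L v3 v4 \<and> \<not> L v2 v4)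
        - of_bool (\<not> L v1 v2 \<and> \<not> L v1 v4 \<and> \<not> L v2 v3 \<and> \<not> L v3 v4 \<and> \<not> L v1 v3)
        - 2 * of_bool (\<not> L v1 v2 \<and> \<not> L v1 v3 \<and> \<not> L v2 v4 \<and> \<not> L v3 v4)
        + of_bool (\<not> L v1 v2 \<and> \<not> L v1 v3 \<and> \<not> L v2 v4 \<and> \<not> L v3 v4 \<and> \<not> L v2 v3)
        + (of_bool (\<not> L v1 v2 \<and> \<not> L v1 v3 \<and> \<not> L v2 v4 \<and> \<not> L v3 v4 \<and> \<not> L v1 v4) :: real)"
    by (rule bool[THEN spec, THEN spec, THEN spec, THEN spec, THEN spec, THEN spec, THEN mp])
       (intro conjI impI; elim conjE; rule t[unfolded s]; assumption)
  ultimately show ?thesis by (simp only: s)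
qed

text \<open>Two vertices \<open>v1\<close>, \<open>v3\<close> with the same weights to the rest of the graph are compared with
  two vertices \<open>v2\<close>, \<open>v4\<close> of the same kind. The inequality already holds conditionally on the
  configuration outside these four vertices.\<close>

lemma twin_inequality:
  assumes fin: "finite N" and W: "{v1, v2, v3, v4} \<subseteq> N" and dist: "distinct [v1, v2, v3, v4]"
    and r01: "\<And>e. e \<in> nsets N 2 \<Longrightarrow> 0 \<le> r e \<and> r e \<le> 1"
    and twin13: "\<And>x. x \<in> N - {v1, v2, v3, v4} \<Longrightarrow> r {v1, x} = r {v3, x}"
    and twin24: "\<And>x. x \<in> N - {v1, v2, v3, v4} \<Longrightarrow> r {v2, x} = r {v4, x}"
    and zero: "r {v1, v2} = 0" "r {v1, v4} = 0" "r {v3, v2} = 0" "r {v3, v4} = 0"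
  shows "link_prob N r v1 v4 + link_prob N r v3 v2 \<le> link_prob N r v1 v3 + link_prob N r v2 v4"
proof -
  let ?W = "{v1, v2, v3, v4}"
  define R where "R = N - ?W"
  have N: "N = ?W \<union> R" using W by (auto simp: R_def)
  have R: "finite ?W" "finite R" "?W \<inter> R = {}" using fin by (auto simp: R_def)
  \<comment> \<open>The probabilities that the two direct edges are closed.\<close>
  define s t where "s = 1 - r {v1, v3}" "t = 1 - r {v2, v4}"
  have st: "0 \<le> s" "s \<le> 1" "0 \<le> t" "t \<le> 1"
    using r01[of "{v1, v3}"] r01[of "{v2, v4}"] W dist by (auto simp: s_t_def nsets_2_pair)
  define T where "T = (\<Union>i\<in>?W. star i R)"
  have ne: "v1 \<noteq> v2" "v2 \<noteq> v1" "v1 \<noteq> v3" "v3 \<noteq> v1" "v1 \<noteq> v4" "v4 \<noteq> v1"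
    "v2 \<noteq> v3" "v3 \<noteq> v2" "v2 \<noteq> v4" "v4 \<noteq> v2" "v3 \<noteq> v4" "v4 \<noteq> v3"
    using dist by auto
  have main: "0 \<le> rexp (nsets ?W 2) r (\<lambda>D. rexp T r (\<lambda>B.
      of_bool (linked (A \<union> D \<union> B) v1 v3) + of_bool (linked (A \<union> D \<union> B) v2 v4)
      - of_bool (linked (A \<union> D \<union> B) v1 v4) - of_bool (linked (A \<union> D \<union> B) v3 v2)))"
    if A: "A \<subseteq> nsets R 2" for A
  proof -
    define sep where "sep \<tau> = rexp (nsets ?W 2) r (\<lambda>D. rexp T r (\<lambda>B.
      of_bool (\<forall>i\<in>?W. \<forall>j\<in>?W. \<tau> i \<noteq> \<tau> j \<longrightarrow> \<not> linked (A \<union> D \<union> B) i j)))" for \<tau> :: "'a \<Rightarrow> nat"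
    let ?\<tau>13_24 = "\<lambda>x. if x = v1 \<or> x = v3 then 0 else (1 :: nat)"
    let ?\<tau>13 = "\<lambda>x. if x = v1 \<or> x = v3 then 0 else if x = v2 then 1 else (2 :: nat)"
    let ?\<tau>24 = "\<lambda>x. if x = v2 \<or> x = v4 then 0 else if x = v1 then 1 else (2 :: nat)"
    let ?\<tau>14_23 = "\<lambda>x. if x = v1 \<or> x = v4 then 0 else (1 :: nat)"
    let ?\<tau>14 = "\<lambda>x. if x = v1 \<or> x = v4 then 0 else if x = v2 then 1 else (2 :: nat)"
    let ?\<tau>23 = "\<lambda>x. if x = v3 \<or> x = v2 then 0 else if x = v1 then 1 else (2 :: nat)"
    let ?f = "\<lambda>D B. of_bool (linked (A \<union> D \<union> B) v1 v3) + of_bool (linked (A \<union> D \<union> B) v2 v4)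
      - of_bool (linked (A \<union> D \<union> B) v1 v4) - of_bool (linked (A \<union> D \<union> B) v3 v2) :: real"
    have id: "rexp (nsets ?W 2) r (\<lambda>D. rexp T r (?f D))
      = 2 * sep ?\<tau>13_24 - sep ?\<tau>13 - sep ?\<tau>24 - 2 * sep ?\<tau>14_23 + sep ?\<tau>14 + sep ?\<tau>23"
    proof -
      let ?s = "\<lambda>C \<tau>. of_bool (\<forall>i\<in>?W. \<forall>j\<in>?W. \<tau> i \<noteq> \<tau> j \<longrightarrow> \<not> linked C i j) :: real"
      have "rexp (nsets ?W 2) r (\<lambda>D. rexp T r (?f D)) = rexp (nsets ?W 2) r (\<lambda>D. rexp T r (\<lambda>B.
          2 * ?s (A \<union> D \<union> B) ?\<tau>13_24 - ?s (A \<union> D \<union> B) ?\<tau>13 - ?s (A \<union> D \<union> B) ?\<tau>24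
          - 2 * ?s (A \<union> D \<union> B) ?\<tau>14_23 + ?s (A \<union> D \<union> B) ?\<tau>14 + ?s (A \<union> D \<union> B) ?\<tau>23))"
        by (intro rexp_cong refl four_point_identity linked_commute dist) (rule linked_trans)
      then show ?thesis unfolding sep_def
        by (simp only: rexp_add rexp_diff rexp_cmult)
    qed
    define crossing where "crossing \<tau> = (\<Prod>e\<in>nsets ?W 2 \<inter>
        {{i, j} |i j. i \<in> ?W \<and> j \<in> ?W \<and> \<tau> i \<noteq> \<tau> j}. 1 - r e)" for \<tau> :: "'a \<Rightarrow> nat"
    have crossing: "crossing \<tau> = (if \<tau> v1 \<noteq> \<tau> v3 then s else 1) * (if \<tau> v2 \<noteq> \<tau> v4 then t else 1)" for \<tau>
    proof -
      define X where "X = {{i, j} |i j. i \<in> ?W \<and> j \<in> ?W \<and> \<tau> i \<noteq> \<tau> j}"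
      have X: "{i, j} \<in> X \<longleftrightarrow> \<tau> i \<noteq> \<tau> j" if "i \<in> ?W" "j \<in> ?W" for i j
        using that unfolding X_def by (auto simp only: doubleton_eq_iff mem_Collect_eq)
      have "crossing \<tau> = (\<Prod>e\<in>nsets ?W 2. if e \<in> X then 1 - r e else 1)"
        unfolding crossing_def X_def by (rule prod.inter_restrict) (simp add: finite_nsets_2)
      also have "\<dots> = (\<Prod>e\<in>{{v1, v3}, {v2, v4}}. if e \<in> X then 1 - r e else 1)"
        unfolding nsets_4[OF dist]
      proof (rule prod.mono_neutral_right)
        show "\<forall>e\<in>{{v1, v3}, {v2, v4}, {v1, v2}, {v1, v4}, {v3, v2}, {v3, v4}} - {{v1, v3}, {v2, v4}}.
            (if e \<in> X then 1 - r e else 1) = 1"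
        proof
          fix e assume "e \<in> {{v1, v3}, {v2, v4}, {v1, v2}, {v1, v4}, {v3, v2}, {v3, v4}}
            - {{v1, v3}, {v2, v4}}"
          then have "e \<in> {{v1, v2}, {v1, v4}, {v3, v2}, {v3, v4}}" by blast
          then have "r e = 0" using zero by (elim insertE emptyE) simp_all
          then show "(if e \<in> X then 1 - r e else 1) = 1" by simp
        qed
      qed auto
      also have "\<dots> = (if {v1, v3} \<in> X then s else 1) * (if {v2, v4} \<in> X then t else 1)"
        using dist by (simp add: s_t_def doubleton_eq_iff)
      also have "\<dots> = (if \<tau> v1 \<noteq> \<tau> v3 then s else 1) * (if \<tau> v2 \<noteq> \<tau> v4 then t else 1)"
        by (simp only: X insert_iff simp_thms)
      finally show ?thesis .
    qed
    define cell_sep where "cell_sep \<tau> c = rexp ?W (\<lambda>i. 1 - miss r i c)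
        (\<lambda>K. of_bool (\<forall>i\<in>K. \<forall>j\<in>K. \<tau> i = \<tau> j))" for \<tau> :: "'a \<Rightarrow> nat" and c
    have sep: "sep \<tau> = crossing \<tau> * (\<Prod>c\<in>cells R A. cell_sep \<tau> c)" for \<tau>
      unfolding sep_def T_def crossing_def cell_sep_def by (rule separation_probability[OF R A])
    define a b where "a c = miss r v1 c" "b c = miss r v2 c" for c
    have sub: "c \<subseteq> R" if "c \<in> cells R A" for c using cells_subset[OF that] .
    have miss_eq: "miss r v3 c = a c" "miss r v4 c = b c" if "c \<in> cells R A" for c
    proof -
      have "r {v3, x} = r {v1, x}" "r {v4, x} = r {v2, x}" if "x \<in> c" for x
      proof -
        have "x \<in> N - ?W" using that sub[OF \<open>c \<in> cells R A\<close>] R_def by blast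
        then show "r {v3, x} = r {v1, x}" "r {v4, x} = r {v2, x}"
          by (simp_all only: twin13 twin24)
      qed
      then show "miss r v3 c = a c" "miss r v4 c = b c"
        unfolding a_b_def miss_def by simp_all
    qed
    have ab: "0 \<le> a c \<and> a c \<le> 1 \<and> 0 \<le> b c \<and> b c \<le> 1" if "c \<in> cells R A" for c
    proof -
      have "0 \<le> 1 - r {i, x} \<and> 1 - r {i, x} \<le> 1" if "i \<in> ?W" "x \<in> c" for i x
        using r01[of "{i, x}"] that sub[OF \<open>c \<in> cells R A\<close>] W by (auto simp: nsets_2_pair R_def)
      then show ?thesis unfolding a_b_def miss_def
        by (auto intro!: prod_nonneg prod_le_1)
    qed
    \<comment> \<open>With probability \<open>m c\<close>, at most one of the four vertices hits \<open>c\<close>. It is hit exactly by \<open>v1\<close>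
      and \<open>v3\<close> with probability \<open>u c * u c\<close>, by \<open>v2\<close> and \<open>v4\<close> with probability \<open>v c * v c\<close>, and by
      \<open>v1\<close> and \<open>v4\<close>, and likewise by \<open>v2\<close> and \<open>v3\<close>, with probability \<open>u c * v c\<close>.\<close>
    define u v m where "u c = (1 - a c) * b c" "v c = a c * (1 - b c)"
      "m c = a c * a c * (b c * b c) + 2 * ((1 - a c) * a c * (b c * b c))
        + 2 * ((1 - b c) * b c * (a c * a c))" for c
    have cell: "cell_sep ?\<tau>13_24 c = m c + (u c * u c + v c * v c)"
      "cell_sep ?\<tau>13 c = m c + u c * u c" "cell_sep ?\<tau>24 c = m c + v c * v c"
      "cell_sep ?\<tau>14_23 c = m c + 2 * (u c * v c)"
      "cell_sep ?\<tau>14 c = m c + u c * v c" "cell_sep ?\<tau>23 c = m c + u c * v c"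
      if "c \<in> cells R A" for c
      by (simp_all add: ne miss_eq[OF that] cell_sep_def rexp_insert u_v_m_def flip: a_b_def)
         (simp_all add: algebra_simps)
    have pos: "0 \<le> m c \<and> 0 \<le> u c \<and> 0 \<le> v c" if "c \<in> cells R A" for c
      using ab[OF that] by (simp add: u_v_m_def)
    let ?P = "\<lambda>f. \<Prod>c\<in>cells R A. m c + f c"
    define P where "P = ?P (\<lambda>c. u c * u c + v c * v c)"
    define Pu Pv where "Pu = ?P (\<lambda>c. u c * u c)" "Pv = ?P (\<lambda>c. v c * v c)"
    define Pd Pe where "Pd = ?P (\<lambda>c. 2 * (u c * v c))" "Pe = ?P (\<lambda>c. u c * v c)"
    have ineq: "Pu \<le> P" "Pv \<le> P" "2 * Pd - 2 * Pe \<le> 2 * P - Pu - Pv"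
      unfolding P_def Pu_Pv_def Pd_Pe_def
      by (rule twin_products[OF finite_cells[OF R(2)]], rule pos, assumption)+
    have "0 \<le> P" unfolding P_def using pos by (intro prod_nonneg) auto
    have seps: "sep ?\<tau>13_24 = P" "sep ?\<tau>13 = t * Pu" "sep ?\<tau>24 = s * Pv"
      "sep ?\<tau>14_23 = s * t * Pd" "sep ?\<tau>14 = s * t * Pe" "sep ?\<tau>23 = s * t * Pe"
      unfolding sep crossing P_def Pu_Pv_def Pd_Pe_def using cell by (simp_all add: ne)
    have 1: "s * t * (2 * Pd - 2 * Pe) \<le> s * t * (2 * P - Pu - Pv)"
      using st ineq by (intro mult_left_mono) auto
    have 2: "t * (1 - s) * Pu \<le> t * (1 - s) * P" "s * (1 - t) * Pv \<le> s * (1 - t) * P"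
      using st ineq by (intro mult_left_mono; simp)+
    have 3: "0 \<le> (1 - s) * P" "0 \<le> (1 - t) * P" using st \<open>0 \<le> P\<close> by auto
    have "0 \<le> 2 * P - t * Pu - s * Pv - 2 * (s * t * Pd) + s * t * Pe + s * t * Pe"
      using 1 2 3 by (simp add: algebra_simps)
    then show ?thesis unfolding id seps by simp
  qed
  have "0 \<le> rexp (nsets R 2) r (\<lambda>A. rexp (nsets ?W 2) r (\<lambda>D. rexp T r (\<lambda>B.
      of_bool (linked (A \<union> D \<union> B) v1 v3) + of_bool (linked (A \<union> D \<union> B) v2 v4)
      - of_bool (linked (A \<union> D \<union> B) v1 v4) - of_bool (linked (A \<union> D \<union> B) v3 v2))))"
  proof (rule rexp_nonneg[OF _ _ main])
    show "0 \<le> r e \<and> r e \<le> 1" if "e \<in> nsets R 2" for e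
      using r01 that nsets_mono[of R N 2] N by blast
  qed (use R finite_nsets_2 in auto)
  also have "\<dots> = rexp (nsets N 2) r (\<lambda>C.
      of_bool (linked C v1 v3) + of_bool (linked C v2 v4)
      - of_bool (linked C v1 v4) - of_bool (linked C v3 v2))"
    unfolding N T_def by (rule rexp_split[OF R, symmetric])
  finally show ?thesis
    by (simp add: link_prob_def rexp_add rexp_diff)
qed

section \<open>Averaging over the neighbours of a vertex\<close>

text \<open>The vertices \<open>v1\<close> and \<open>v2\<close> have neighbourhoods \<open>X\<close> and \<open>Y\<close>, all of whose edges are open
  with probability \<open>p\<close>. Given the configuration on the other vertices, either \<open>v1\<close> and \<open>v2\<close> reach
  a cell \<open>c\<close> both or not at all, or they share no other cell and exactly one of them hits \<open>c\<close>. So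
  the vertex with more neighbours in \<open>c\<close> is at least as likely to reach \<open>c\<close>.\<close>

lemma neighbour_average:
  assumes fin: "finite N" and W: "v1 \<in> N" "v2 \<in> N" "v1 \<noteq> v2"
    and r01: "\<And>e. e \<in> nsets N 2 \<Longrightarrow> 0 \<le> r e \<and> r e \<le> 1"
    and X: "X \<subseteq> N - {v1, v2}" and Y: "Y \<subseteq> N - {v1, v2}" and p: "0 \<le> p" "p \<le> 1"
    and r1: "\<And>x. x \<in> N - {v1, v2} \<Longrightarrow> r {v1, x} = (if x \<in> X then p else 0)"
    and r2: "\<And>x. x \<in> N - {v1, v2} \<Longrightarrow> r {v2, x} = (if x \<in> Y then p else 0)"
    and r12: "r {v1, v2} = 0"
  shows "(\<Sum>y\<in>Y. link_prob N r v1 y - link_prob N r v2 y)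
    \<le> (\<Sum>x\<in>X. link_prob N r v1 x - link_prob N r v2 x)"
proof -
  let ?W = "{v1, v2}"
  define R where "R = N - ?W"
  have N: "N = ?W \<union> R" using W by (auto simp: R_def)
  have R: "finite ?W" "finite R" "?W \<inter> R = {}" using fin by (auto simp: R_def)
  have XY: "X \<subseteq> R" "Y \<subseteq> R" using X Y by (auto simp: R_def)
  define T where "T = (\<Union>i\<in>?W. star i R)"
  let ?d = "\<lambda>C x. of_bool (linked C v1 x) - of_bool (linked C v2 x) :: real"
  have "nsets ?W 2 = {{v1, v2}}"
    using W(3) by (auto simp: nsets_def card_2_iff)
  then have direct: "rexp (nsets ?W 2) r f = f {}" for f
    using r12 rexp_insert[of "{}" "{v1, v2}" r f] by simp
  have split: "rexp (nsets N 2) r f = rexp (nsets R 2) r (\<lambda>A. rexp T r (\<lambda>B. f (A \<union> B)))" for f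
    unfolding N T_def rexp_split[OF R] direct by simp
  have main: "(\<Sum>y\<in>Y. rexp T r (\<lambda>B. ?d (A \<union> B) y)) \<le> (\<Sum>x\<in>X. rexp T r (\<lambda>B. ?d (A \<union> B) x))"
    if A: "A \<subseteq> nsets R 2" for A
  proof -
    \<comment> \<open>At the cell of \<open>x\<close> it matters which of \<open>v1\<close>, \<open>v2\<close> hit it; every other cell must not be
      hit by both.\<close>
    define share where "share K = (of_bool (\<not> (v1 \<in> K \<and> v2 \<in> K)) :: real)" for K
    define excess where "excess K = (of_bool (v1 \<in> K) - of_bool (v2 \<in> K) :: real)" for K
    have point: "?d (A \<union> B) x = (\<Prod>c'\<in>cells R A. (if c' = c then excess else share) (hits B ?W c'))"
      if B: "B \<subseteq> T" and c: "c \<in> cells R A" "x \<in> c" for B c x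
    proof -
      interpret split_configuration ?W R A "{}" B
        using R A B by unfold_locales (auto simp: T_def)
      have prod: "(\<Prod>c'\<in>cells R A. (if c' = c then excess else share) (hits B ?W c'))
        = excess (hits B ?W c) * (\<Prod>c'\<in>cells R A - {c}. share (hits B ?W c'))"
        using c finite_cells[OF R(2)] by (subst prod.remove[of _ c]) auto
      show ?thesis
      proof (cases "linked (A \<union> B) v1 v2")
        case True
        then have "?d (A \<union> B) x = 0"
          using linked_trans linked_sym by (smt (verit) diff_self)
        moreover have "\<not> (\<forall>c\<in>cells R A. \<forall>i\<in>hits B ?W c. \<forall>j\<in>hits B ?W c. (i = v1) = (j = v1))"
          using separated_iff[of "\<lambda>i. i = v1"] True W(3) by auto
        then obtain c' i j where "c' \<in> cells R A" "i \<in> hits B ?W c'" "j \<in> hits B ?W c'"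
          "i = v1" "j \<noteq> v1"
          by metis
        moreover from this have "j = v2" by (auto simp: hits_iff)
        ultimately have c': "c' \<in> cells R A" "v1 \<in> hits B ?W c'" "v2 \<in> hits B ?W c'" and
          zero: "?d (A \<union> B) x = 0" by auto
        then have "excess (hits B ?W c) * (\<Prod>c'\<in>cells R A - {c}. share (hits B ?W c')) = 0"
          using finite_cells[OF R(2), of A] by (cases "c' = c") (auto simp: excess_def share_def)
        with zero show ?thesis using prod by simp
      next
        case False
        then have "linked (A \<union> B) v1 x \<longleftrightarrow> v1 \<in> hits B ?W c"
          "linked (A \<union> B) v2 x \<longleftrightarrow> v2 \<in> hits B ?W c"
          using linked_cell_iff[of v1 c x] linked_cell_iff[of v2 c x] c linked_sym[of _ v2 v1] by auto
        moreover have "\<forall>c\<in>cells R A. \<forall>i\<in>hits B ?W c. \<forall>j\<in>hits B ?W c. (i = v1) = (j = v1)"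
          using separated_iff[of "\<lambda>i. i = v1"] False linked_sym[of _ v2 v1] W(3) by auto
        then have "share (hits B ?W c') = 1" if "c' \<in> cells R A" for c'
          using W(3) that unfolding share_def by fastforce
        ultimately show ?thesis using prod by (simp add: excess_def)
      qed
    qed
    define a b where "a c = miss r v1 c" "b c = miss r v2 c" for c
    define K where "K c = (\<Prod>c'\<in>cells R A - {c}.
        rexp ?W (\<lambda>i. 1 - miss r i c') share)" for c
    have E: "rexp T r (\<lambda>B. ?d (A \<union> B) x) = (b c - a c) * K c"
      if c: "c \<in> cells R A" "x \<in> c" for c x
    proof -
      have "rexp T r (\<lambda>B. ?d (A \<union> B) x) = rexp T r (\<lambda>B.
          \<Prod>c'\<in>cells R A. (if c' = c then excess else share) (hits B ?W c'))"
        using point[OF _ c] by (intro rexp_cong) auto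
      also have "\<dots> = (\<Prod>c'\<in>cells R A. rexp ?W (\<lambda>i. 1 - miss r i c') (if c' = c then excess else share))"
        unfolding T_def by (rule rexp_cells[OF R])
      also have "\<dots> = rexp ?W (\<lambda>i. 1 - miss r i c) excess * K c"
        unfolding K_def using c finite_cells[OF R(2), of A] by (subst prod.remove[of _ c]) auto
      also have "rexp ?W (\<lambda>i. 1 - miss r i c) excess = b c - a c"
        using W(3) by (simp add: rexp_insert excess_def a_b_def algebra_simps)
      finally show ?thesis .
    qed
    have sub: "c \<subseteq> R" "finite c" if "c \<in> cells R A" for c
      using cells_subset[OF that] R(2) finite_subset by auto
    have ab: "a c = (1 - p) ^ card (c \<inter> X)" "b c = (1 - p) ^ card (c \<inter> Y)"
      if "c \<in> cells R A" for c
    proof -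
      have pow: "(\<Prod>x\<in>c. if x \<in> Z then 1 - p else 1) = (1 - p) ^ card (c \<inter> Z)" for Z
        using prod.inter_restrict[OF sub(2)[OF that], of "\<lambda>_. 1 - p" Z] by simp
      have "a c = (\<Prod>x\<in>c. if x \<in> X then 1 - p else 1)" "b c = (\<Prod>x\<in>c. if x \<in> Y then 1 - p else 1)"
      proof -
        have "x \<in> N - ?W" if "x \<in> c" for x
          using that sub(1)[OF \<open>c \<in> cells R A\<close>] R_def by blast
        then show "a c = (\<Prod>x\<in>c. if x \<in> X then 1 - p else 1)"
          "b c = (\<Prod>x\<in>c. if x \<in> Y then 1 - p else 1)"
          unfolding a_b_def miss_def by (intro prod.cong refl; simp only: r1 r2; simp)+
      qed
      then show "a c = (1 - p) ^ card (c \<inter> X)" "b c = (1 - p) ^ card (c \<inter> Y)"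
        using pow by auto
    qed
    have K0: "0 \<le> K c" for c
      unfolding K_def
    proof (intro prod_nonneg rexp_nonneg)
      fix c' i assume c': "c' \<in> cells R A - {c}" and i: "i \<in> ?W"
      have "0 \<le> 1 - r {i, x} \<and> 1 - r {i, x} \<le> 1" if "x \<in> c'" for x
        using r01[of "{i, x}"] that sub(1)[of c'] c' i W by (auto simp: nsets_2_pair R_def)
      then have "0 \<le> miss r i c'" "miss r i c' \<le> 1"
        unfolding miss_def by (auto intro!: prod_nonneg prod_le_1)
      then show "0 \<le> 1 - miss r i c' \<and> 1 - miss r i c' \<le> 1" by simp
    qed (auto simp: share_def)
    have sum: "(\<Sum>z\<in>Z. rexp T r (\<lambda>B. ?d (A \<union> B) z))
        = (\<Sum>c\<in>cells R A. real (card (c \<inter> Z)) * ((b c - a c) * K c))" if "Z \<subseteq> R" for Z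
    proof -
      have "(\<Sum>z\<in>Z. rexp T r (\<lambda>B. ?d (A \<union> B) z))
          = (\<Sum>z\<in>(\<Union>c\<in>cells R A. c \<inter> Z). rexp T r (\<lambda>B. ?d (A \<union> B) z))"
        using that Union_cells[of R A] by (intro sum.cong) auto
      also have "\<dots> = (\<Sum>c\<in>cells R A. \<Sum>z\<in>c \<inter> Z. rexp T r (\<lambda>B. ?d (A \<union> B) z))"
        using cells_disjoint[of _ R A] finite_cells[OF R(2), of A] sub(2)
        by (intro sum.UNION_disjoint) blast+
      also have "\<dots> = (\<Sum>c\<in>cells R A. \<Sum>z\<in>c \<inter> Z. (b c - a c) * K c)"
        by (intro sum.cong refl E) auto
      finally show ?thesis by simp
    qed
    have "real (card (c \<inter> Y)) * ((b c - a c) * K c) \<le> real (card (c \<inter> X)) * ((b c - a c) * K c)"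
      if "c \<in> cells R A" for c
    proof (cases "card (c \<inter> Y) \<le> card (c \<inter> X)")
      case True
      then have "a c \<le> b c" unfolding ab[OF that] using p by (intro power_decreasing) auto
      then show ?thesis using True K0 by (intro mult_right_mono) auto
    next
      case False
      then have "b c \<le> a c" unfolding ab[OF that] using p by (intro power_decreasing) auto
      then show ?thesis using False K0
        by (intro mult_right_mono_neg) (auto simp: mult_nonpos_nonneg)
    qed
    then show ?thesis unfolding sum[OF XY(1)] sum[OF XY(2)] by (rule sum_mono)
  qed
  have eq: "(\<Sum>z\<in>Z. link_prob N r v1 z - link_prob N r v2 z)
      = rexp (nsets R 2) r (\<lambda>A. \<Sum>z\<in>Z. rexp T r (\<lambda>B. ?d (A \<union> B) z))" for Z
    unfolding link_prob_def rexp_sum rexp_diff[symmetric] by (simp only: split)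
  show ?thesis
    unfolding eq
  proof (rule rexp_mono[OF _ main])
    show "0 \<le> r e \<and> r e \<le> 1" if "e \<in> nsets R 2" for e
      using r01 that nsets_mono[of R N 2] N by blast
  qed
qed

section \<open>Bunkbed graphs over two classes of vertices\<close>

lemma layer_UNIV: "{Plus, Minus} = UNIV"
  using layer.exhaust by blast

text \<open>The random graph on the bunkbed vertices over \<open>V = V1 \<union> V2\<close> in which horizontal edges have
  weight \<open>0\<close> within \<open>V1\<close>, weight \<open>p'\<close> within \<open>V2\<close> and weight \<open>p\<close> between the classes, and the
  vertical edge at \<open>u\<close> is open if and only if \<open>u \<in> H\<close>.\<close>

locale two_class_bunkbed =
  fixes V V1 V2 H :: "'a set" and p p' :: real and r :: "('a \<times> layer) set \<Rightarrow> real"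
  assumes finite_V: "finite V" and V: "V = V1 \<union> V2" and disj: "V1 \<inter> V2 = {}"
    and p: "0 \<le> p" "p \<le> 1" and p': "0 \<le> p'" "p' \<le> 1"
    and r: "\<And>u v s t. u \<in> V \<Longrightarrow> v \<in> V \<Longrightarrow> (u, s) \<noteq> (v, t) \<Longrightarrow>
      r {(u, s), (v, t)} = (if u = v then of_bool (u \<in> H) else if s \<noteq> t then 0
        else if u \<in> V1 \<and> v \<in> V1 then 0 else if u \<in> V2 \<and> v \<in> V2 then p' else p)"
begin

abbreviation N where "N \<equiv> bunkbed_verts V"
abbreviation L where "L \<equiv> link_prob N r"

lemma mem_N [simp]: "(u, s) \<in> N \<longleftrightarrow> u \<in> V"
  by (simp add: bunkbed_verts_def layer_UNIV)

lemma finite_N: "finite N"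
  using finite_V by (simp add: bunkbed_verts_def)

lemma edge_obtain:
  assumes "e \<in> nsets N 2"
  obtains u s v t where "e = {(u, s), (v, t)}" "(u, s) \<noteq> (v, t)" "u \<in> V" "v \<in> V"
proof -
  from assms obtain x y where e: "e = {x, y}" "x \<noteq> y" by (auto simp: nsets_def card_2_iff)
  obtain u s v t where "x = (u, s)" "y = (v, t)" by fastforce
  with e assms that[of u s v t] show thesis by (auto simp: nsets_2_pair)
qed

lemma r01: "e \<in> nsets N 2 \<Longrightarrow> 0 \<le> r e \<and> r e \<le> 1"
  by (erule edge_obtain) (use p p' in \<open>simp add: r\<close>)

lemma automorphism:
  assumes "bij \<pi>" "inj \<sigma>" "\<And>u. \<pi> u \<in> V1 \<longleftrightarrow> u \<in> V1" "\<And>u. \<pi> u \<in> V2 \<longleftrightarrow> u \<in> V2"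
    "\<And>u. \<pi> u \<in> H \<longleftrightarrow> u \<in> H"
  shows "L (\<pi> v, \<sigma> s) (\<pi> w, \<sigma> t) = L (v, s) (w, t)"
proof -
  let ?h = "map_prod \<pi> \<sigma>"
  have V': "\<pi> u \<in> V \<longleftrightarrow> u \<in> V" for u using assms(3,4) by (simp add: V)
  have inj: "inj \<pi>" using assms(1) by (rule bij_is_inj)
  have inj_h: "inj ?h" using inj assms(2) by (rule prod.inj_map)
  have "?h ` N \<subseteq> N" by (auto simp: V')
  moreover have "card (?h ` N) = card N" using inj_h by (intro card_image) (auto intro: inj_on_subset)
  ultimately have "?h ` N = N" using finite_N by (metis card_subset_eq)
  moreover have "r (?h ` e) = r e" if "e \<in> nsets N 2" for e
    using that
  proof (rule edge_obtain)
    fix u s v t assume e: "e = {(u, s), (v, t)}" "(u, s) \<noteq> (v, t)" "u \<in> V" "v \<in> V"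
    have "(\<pi> u, \<sigma> s) \<noteq> (\<pi> v, \<sigma> t)" using e(2) inj assms(2) by (auto simp: inj_eq)
    then have "r {(\<pi> u, \<sigma> s), (\<pi> v, \<sigma> t)} = r {(u, s), (v, t)}"
      using e inj assms(2) by (simp add: r V' assms(3-5) inj_eq)
    then show ?thesis using e(1) by simp
  qed
  ultimately show ?thesis
    using link_prob_automorphism[OF inj_h, of N r "(v, s)" "(w, t)"] by simp
qed

text \<open>Invariance under the exchange of the two layers.\<close>

lemma flip: "L (v, Plus) (w, Plus) = L (v, Minus) (w, Minus)"
  "L (v, Plus) (w, Minus) = L (v, Minus) (w, Plus)"
proof -
  define \<sigma> where "\<sigma> s = (case s of Plus \<Rightarrow> Minus | Minus \<Rightarrow> Plus)" for s
  have "inj \<sigma>" by (rule injI) (auto simp: \<sigma>_def split: layer.splits)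
  then have "L (id v, \<sigma> s) (id w, \<sigma> t) = L (v, s) (w, t)" for s t
    by (intro automorphism bij_id) auto
  from this[of Plus Plus] this[of Plus Minus]
  show "L (v, Plus) (w, Plus) = L (v, Minus) (w, Minus)"
    "L (v, Plus) (w, Minus) = L (v, Minus) (w, Plus)"
    by (simp_all add: \<sigma>_def)
qed

lemma post:
  assumes "w \<in> V" "w \<in> H"
  shows "L x (w, Minus) = L x (w, Plus)"
proof -
  have "L (w, Minus) x = L (w, Plus) x"
    using assms by (intro link_prob_sure_edge finite_N) (auto simp: r)
  then show ?thesis by (simp add: link_prob_commute)
qed

lemma different_classes:
  assumes "v \<in> V1" "w \<in> V2" "v \<notin> H" "w \<notin> H"
  shows "L (v, Minus) (w, Plus) \<le> L (v, Minus) (w, Minus)"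
proof -
  define g where "g u = L (v, Minus) (u, Minus) - L (v, Minus) (u, Plus)" for u
  have vV: "v \<in> V" "v \<notin> V2" using assms disj by (auto simp: V)
  have V2: "V2 \<subseteq> V" by (auto simp: V)
  have fin: "finite V2" using finite_V by (simp add: V)
  have avg: "(\<Sum>y\<in>V2 \<times> {Plus}. L (v, Minus) y - L (v, Plus) y)
      \<le> (\<Sum>x\<in>V2 \<times> {Minus}. L (v, Minus) x - L (v, Plus) x)"
  proof (rule neighbour_average[where p = p])
    fix x assume x: "x \<in> N - {(v, Minus), (v, Plus)}"
    obtain u s where us: "x = (u, s)" by fastforce
    have u: "u \<in> V" "u \<noteq> v"
      using x us layer_UNIV by auto
    show "r {(v, Minus), x} = (if x \<in> V2 \<times> {Minus} then p else 0)"
      "r {(v, Plus), x} = (if x \<in> V2 \<times> {Plus} then p else 0)"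
      using u vV assms(1) disj unfolding us by (auto simp: r) (auto simp: V)
  qed (use vV V2 assms p r01 finite_N in \<open>auto simp: r\<close>)
  have sum: "(\<Sum>x\<in>V2 \<times> {s}. f x) = (\<Sum>u\<in>V2. f (u, s))" for f :: "'a \<times> layer \<Rightarrow> real" and s
  proof -
    have "V2 \<times> {s} = (\<lambda>u. (u, s)) ` V2" by auto
    then show ?thesis by (simp add: sum.reindex inj_on_def)
  qed
  have "0 \<le> (\<Sum>u\<in>V2. g u)"
    using avg by (simp add: sum flip g_def sum_subtractf)
  also have "(\<Sum>u\<in>V2. g u) = (\<Sum>u\<in>V2 - H. g u)"
    using fin post by (intro sum.mono_neutral_right) (auto simp: g_def V)
  \<comment> \<open>Transposing two vertices of \<open>V2 - H\<close> is an automorphism that fixes \<open>v\<close>.\<close>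
  also have "\<dots> = (\<Sum>u\<in>V2 - H. g w)"
  proof (rule sum.cong[OF refl])
    fix u assume u: "u \<in> V2 - H"
    have \<pi>: "Transposition.transpose w u x \<in> S \<longleftrightarrow> x \<in> S" if "w \<in> S \<longleftrightarrow> u \<in> S" for S x
      using that by (auto simp: Transposition.transpose_def)
    have "L (Transposition.transpose w u v, id s) (Transposition.transpose w u w, id t) = L (v, s) (w, t)" for s t
      using u assms disj by (intro automorphism \<pi>) auto
    moreover have "Transposition.transpose w u v = v"
      using u vV assms by (auto simp: Transposition.transpose_def)
    ultimately show "g u = g w" by (simp add: g_def)
  qed
  finally have "0 \<le> real (card (V2 - H)) * g w" by simp
  moreover have "0 < card (V2 - H)" using fin assms by (auto simp: card_gt_0_iff)
  ultimately have "0 \<le> g w" by (simp add: zero_le_mult_iff)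
  then show ?thesis by (simp add: g_def)
qed

lemma same_class:
  assumes "v \<in> V" "w \<in> V" "v \<in> V1 \<longleftrightarrow> w \<in> V1" "v \<notin> H" "w \<notin> H" "v \<noteq> w"
  shows "L (v, Minus) (w, Plus) \<le> L (v, Minus) (w, Minus)"
proof -
  have c: "v \<in> V2 \<longleftrightarrow> w \<in> V2" using assms disj by (auto simp: V)
  have "L (v, Minus) (w, Plus) + L (w, Minus) (v, Plus)
      \<le> L (v, Minus) (w, Minus) + L (v, Plus) (w, Plus)"
  proof (rule twin_inequality)
    fix x assume x: "x \<in> N - {(v, Minus), (v, Plus), (w, Minus), (w, Plus)}"
    obtain u s where us: "x = (u, s)" by fastforce
    have u: "u \<in> V" "u \<noteq> v" "u \<noteq> w"
      using x us layer_UNIV by auto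
    show "r {(v, Minus), x} = r {(w, Minus), x}" "r {(v, Plus), x} = r {(w, Plus), x}"
      using u assms c unfolding us by (simp_all add: r)
  qed (use assms r01 finite_N in \<open>auto simp: r\<close>)
  then show ?thesis
    using flip link_prob_commute[of N r "(w, Minus)" "(v, Plus)"] by simp
qed

theorem bunkbed_inequality:
  assumes "v \<in> V" "w \<in> V"
  shows "L (v, Minus) (w, Plus) \<le> L (v, Minus) (w, Minus)"
proof -
  consider "v = w" | "w \<in> H" | "v \<in> H" | "v \<noteq> w" "v \<notin> H" "w \<notin> H" "v \<in> V1 \<longleftrightarrow> w \<in> V1"
    | "v \<notin> H" "w \<notin> H" "v \<in> V1" "w \<in> V2" | "v \<notin> H" "w \<notin> H" "v \<in> V2" "w \<in> V1"
    using assms V by blast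
  then show ?thesis
  proof cases
    case 1
    then show ?thesis using link_prob_le_one[OF finite_N r01] by (simp add: finite_N)
  next
    case 2
    then show ?thesis using post assms by simp
  next
    case 3
    then have "L (v, Minus) (w, Minus) = L (v, Minus) (w, Plus)"
      using post[of v "(w, Minus)"] assms flip by (simp add: link_prob_commute)
    then show ?thesis by simp
  next
    case 6
    then have "L (w, Minus) (v, Plus) \<le> L (w, Minus) (v, Minus)" by (intro different_classes)
    then show ?thesis using flip by (simp add: link_prob_commute)
  qed (use assms same_class different_classes in blast)+
qed

end

section \<open>Percolation on the bunkbed graph\<close>

lemma conn_prob_eq_link_prob:
  assumes "finite_graph V E"
    and "\<And>e. e \<in> bunkbed_edges V E \<Longrightarrow> 0 \<le> bunkbed_weight pE pV e \<and> bunkbed_weight pE pV e \<le> 1"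
  shows "conn_prob V E pE pV x y = link_prob (bunkbed_verts V)
    (\<lambda>e. if e \<in> bunkbed_edges V E then bunkbed_weight pE pV e else 0) x y"
proof -
  let ?B = "bunkbed_edges V E" and ?N = "bunkbed_verts V"
  have B: "finite ?N" "?B \<subseteq> nsets ?N 2"
    using bunkbed_finite_graph[OF assms(1)] by (auto simp: finite_graph_def)
  then have fin: "finite (nsets ?N 2)" "finite ?B"
    using finite_nsets_2 finite_subset by blast+
  have "conn_prob V E pE pV x y = rexp ?B (bunkbed_weight pE pV)
      (\<lambda>A. of_bool (connected_in V E (\<lambda>e. e \<in> A) x y))"
    unfolding conn_prob_def percolation_def by (rule prob_Pi_pmf_eq_rexp[OF fin(2) assms(2)])
  also have "\<dots> = rexp ?B (\<lambda>e. if e \<in> ?B then bunkbed_weight pE pV e else 0)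
      (\<lambda>A. of_bool (linked A x y))"
  proof (rule rexp_cong)
    fix A assume "A \<subseteq> ?B"
    then have "(\<lambda>x y. {x, y} \<in> ?B \<and> {x, y} \<in> A) = (\<lambda>x y. {x, y} \<in> A)" by blast
    then show "of_bool (connected_in V E (\<lambda>e. e \<in> A) x y) = (of_bool (linked A x y) :: real)"
      by (simp add: connected_in_def linked_def)
  qed simp_all
  also have "\<dots> = link_prob ?N (\<lambda>e. if e \<in> ?B then bunkbed_weight pE pV e else 0) x y"
    unfolding link_prob_def by (rule rexp_weight_zero[symmetric]) (use fin B in auto)
  finally show ?thesis .
qed

lemma conn_prob_two_classes:
  assumes graph: "finite_graph V E" and V: "V = V1 \<union> V2" "V1 \<inter> V2 = {}"
    and p: "0 \<le> p" "p \<le> 1" and p': "0 \<le> p'" "p' \<le> 1"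
    and pE: "\<And>u v. u \<in> V \<Longrightarrow> v \<in> V \<Longrightarrow> u \<noteq> v \<Longrightarrow> (if {u, v} \<in> E then pE {u, v} else 0)
      = (if u \<in> V1 \<and> v \<in> V1 then 0 else if u \<in> V2 \<and> v \<in> V2 then p' else p)"
    and pV: "\<And>u. u \<in> V \<Longrightarrow> pV u = of_bool (u \<in> H)"
    and vw: "v \<in> V" "w \<in> V"
  shows "conn_prob V E pE pV (v, Minus) (w, Plus) \<le> conn_prob V E pE pV (v, Minus) (w, Minus)"
proof -
  let ?B = "bunkbed_edges V E"
  let ?r = "\<lambda>e. if e \<in> ?B then bunkbed_weight pE pV e else 0"
  have loop: "u \<in> V \<and> v \<in> V \<and> u \<noteq> v" if "{u, v} \<in> E" for u v
    using that graph nsets_2_pair[of u v V] unfolding finite_graph_def by blast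
  have vertical: "{(u, s), (u, t)} = {(u, Plus), (u, Minus)}" if "s \<noteq> t" for u :: 'a and s t
    using that by (cases s; cases t) auto
  have horizontal: "{(u, s), (v, s)} \<in> ?B \<longleftrightarrow> {u, v} \<in> E" if "u \<noteq> v" for u v s
    using that by (auto simp: bunkbed_edges_def doubleton_eq_iff insert_commute)
  have diagonal: "{(u, s), (v, t)} \<notin> ?B" if "u \<noteq> v" "s \<noteq> t" for u v s t
    using that by (auto simp: bunkbed_edges_def doubleton_eq_iff)
  have r: "?r {(u, s), (v, t)} = (if u = v then of_bool (u \<in> H) else if s \<noteq> t then 0
        else if u \<in> V1 \<and> v \<in> V1 then 0 else if u \<in> V2 \<and> v \<in> V2 then p' else p)"
    if "u \<in> V" "v \<in> V" "(u, s) \<noteq> (v, t)" for u v s t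
  proof (cases "u = v")
    case True
    have "{(u, Plus), (u, Minus)} \<in> ?B" using that by (auto simp: bunkbed_edges_def)
    then show ?thesis
      using True that vertical[of s t u] pV by (simp add: bunkbed_weight_vertical)
  next
    case False
    show ?thesis
    proof (cases "s = t")
      case True
      have "?r {(u, s), (v, t)} = (if {u, v} \<in> E then pE {u, v} else 0)"
        using horizontal[OF False] bunkbed_weight_horizontal[OF False] True by simp
      also note pE[OF that(1,2) False]
      finally show ?thesis using True False by simp
    qed (use False diagonal in simp)
  qed
  interpret two_class_bunkbed V V1 V2 H p p' ?r
    using graph V p p' r by unfold_locales (auto simp: finite_graph_def)
  have "0 \<le> bunkbed_weight pE pV e \<and> bunkbed_weight pE pV e \<le> 1" if "e \<in> ?B" for e
    using r01[of e] that bunkbed_finite_graph[OF graph] by (auto simp: finite_graph_def)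
  then show ?thesis
    using bunkbed_inequality[OF vw] by (simp add: conn_prob_eq_link_prob[OF graph])
qed

theorem corollary2:
  "(\<forall>(V :: 'a set) E V1 V2 H (p :: real) (p' :: real) pE pV.
      finite_graph V E \<and> is_complete_graph V E
      \<and> V = V1 \<union> V2 \<and> V1 \<inter> V2 = {}
      \<and> H \<subseteq> V
      \<and> p \<in> {0..<1} \<and> p' \<in> {0..<1}
      \<and> (\<forall>u\<in>V1. \<forall>v\<in>V1. u \<noteq> v \<longrightarrow> pE {u, v} = 0)
      \<and> (\<forall>u\<in>V1. \<forall>v\<in>V2. pE {u, v} = p)
      \<and> (\<forall>u\<in>V2. \<forall>v\<in>V2. u \<noteq> v \<longrightarrow> pE {u, v} = p')
      \<and> (\<forall>u\<in>H. pV u = 1)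
      \<and> (\<forall>u\<in>V - H. pV u = 0)
      \<longrightarrow> (\<forall>v\<in>V. \<forall>w\<in>V.
             conn_prob V E pE pV (v, Minus) (w, Minus)
             \<ge> conn_prob V E pE pV (v, Minus) (w, Plus)))
   \<and> (\<forall>(V :: 'a set) E.
        finite_graph V E \<and> complete_bipartite_graph V E \<longrightarrow> bunkbed_property_B2 V E)
   \<and> (\<forall>(V :: 'a set) E U F.
        finite_graph V E \<and> is_complete_graph V E \<and> is_subgraph U F V E \<and> is_complete_graph U F
        \<longrightarrow> bunkbed_property_B2 V (E - F))"
proof (intro conjI allI impI ballI, goal_cases)
  case (1 V E V1 V2 H p p' pE pV v w)
  show ?case
  proof (rule conn_prob_two_classes[of V E V1 V2 p p' pE pV H])
    fix u v assume uv: "u \<in> V" "v \<in> V" "u \<noteq> v"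
    have "{u, v} \<in> E" using 1 uv by (simp add: is_complete_graph_def nsets_2_pair)
    moreover have "pE {u, v} = p" if "u \<in> V2" "v \<in> V1"
      using 1 that by (metis insert_commute)
    ultimately show "(if {u, v} \<in> E then pE {u, v} else 0)
        = (if u \<in> V1 \<and> v \<in> V1 then 0 else if u \<in> V2 \<and> v \<in> V2 then p' else p)"
      using 1 uv by auto
  qed (use 1 in auto)
next
  case (2 V E)
  then obtain A B where AB: "V = A \<union> B" "A \<inter> B = {}" "E = {{a, b} |a b. a \<in> A \<and> b \<in> B}"
    by (auto simp: complete_bipartite_graph_def)
  show ?case
    unfolding bunkbed_property_B2_def
  proof (intro ballI allI impI)
    fix p :: real and H v w assume p: "p \<in> {0..1}" and H: "H \<subseteq> V" and vw: "v \<in> V" "w \<in> V"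
    show "conn_prob V E (\<lambda>_. p) (\<lambda>u. if u \<in> H then 1 else 0) (v, Minus) (w, Plus)
        \<le> conn_prob V E (\<lambda>_. p) (\<lambda>u. if u \<in> H then 1 else 0) (v, Minus) (w, Minus)"
    proof (rule conn_prob_two_classes[of V E A B p 0 _ _ H])
      fix u v assume "u \<in> V" "v \<in> V" "u \<noteq> v"
      then show "(if {u, v} \<in> E then p else 0)
          = (if u \<in> A \<and> v \<in> A then 0 else if u \<in> B \<and> v \<in> B then 0 else p)"
        using AB by (auto simp: doubleton_eq_iff)
    qed (use 2 AB p vw in auto)
  qed
next
  case (3 V E U F)
  then have U: "U \<subseteq> V" "E = nsets V 2" "F = nsets U 2"
    by (auto simp: is_subgraph_def is_complete_graph_def)
  show ?case
    unfolding bunkbed_property_B2_def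
  proof (intro ballI allI impI)
    fix p :: real and H v w assume p: "p \<in> {0..1}" and H: "H \<subseteq> V" and vw: "v \<in> V" "w \<in> V"
    show "conn_prob V (E - F) (\<lambda>_. p) (\<lambda>u. if u \<in> H then 1 else 0) (v, Minus) (w, Plus)
        \<le> conn_prob V (E - F) (\<lambda>_. p) (\<lambda>u. if u \<in> H then 1 else 0) (v, Minus) (w, Minus)"
    proof (rule conn_prob_two_classes[of V "E - F" U "V - U" p p _ _ H])
      fix u v assume "u \<in> V" "v \<in> V" "u \<noteq> v"
      then show "(if {u, v} \<in> E - F then p else 0)
          = (if u \<in> U \<and> v \<in> U then 0 else if u \<in> V - U \<and> v \<in> V - U then p else p)"
        using U by (auto simp: nsets_2_pair)
    qed (use 3 U p vw in \<open>auto simp: finite_graph_def\<close>)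
  qed
qed

end
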